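(* Let $A$ be a primitive complex unital Banach algebra with nonzero socle, let $p$ be a minimal idempotent of $A$, and suppose that $\mathfrak{L}_r(\mathrm{soc}(A))=F_0(Ap)$, where $\mathfrak{L}_r:A\to L(Ap)$, $\mathfrak{L}_r(x)=\widehat{x}$, is the left regular representation of $A$ on $Ap$ and $F_0(Ap)$ is the ideal of finite rank operators in $L(Ap)$. Then the following two conditions are equivalent: (i) For every element $a\in A$, if $\widehat{a}$ is a B-Fredholm operator on the Banach space $Ap$, then $a$ is a B-Fredholm element of $A$. (ii) Each element of the algebra $\mathfrak{L}_r(A)/F_0(Ap)$ which is Drazin invertible in the algebra $L(Ap)/F_0(Ap)$ is also Drazin invertible in $\mathfrak{L}_r(A)/F_0(Ap)$.
   Context: An algebra is primitive if $\{0\}$ is a primitive ideal of it. $A$ denotes a complex unital primitive Banach algebra with nonzero socle $J=\mathrm{soc}(A)$; $\pi:A\to A/J$ is the canonical projection. A minimal idempotent of $A$ is a nonzero idempotent $p$ with $pAp=\mathbb{C}p$. $L(Ap)$ is the Banach algebra of bounded linear operators on the Banach space $Ap$. For $x\in A$, $\widehat{x}:Ap\to Ap$ is the operator $\widehat{x}(y)=xy$, and $\mathfrak{L}_r(x)=\widehat{x}$. An element $x$ of a unital ring $R$ is Drazin invertible in $R$ if there exist $y\in R$ and $k\in\mathbb{N}$ such that $yxy=y$, $xy=yx$ and $x^k y x=x^k$. An element $a\in A$ is a B-Fredholm element of $A$ if $\pi(a)$ is Drazin invertible in $A/J$ (i.e. modulo the socle). A bounded linear operator $T$ on a Banach space $X$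 is a B-Fredholm operator if there is an integer $n\ge 0$ such that the range $R(T^n)$ is closed and the restriction $T_n:R(T^n)\to R(T^n)$ of $T$ is a Fredholm operator. *)

theory Defs
  imports "HOL-Analysis.Analysis" "HOL-Algebra.QuotRing" "HOL-Algebra.Algebraic_Closure_Type"
begin

section \<open>Complex unital Banach algebras\<close>

text \<open>The norm is submultiplicative; \<open>norm 1 = 1\<close> is not required.\<close>

class complex_banach_algebra = real_algebra_1 + real_normed_algebra + banach +
  fixes scaleC :: "complex \<Rightarrow> 'a \<Rightarrow> 'a" (infixr "*\<^sub>C" 75)
  assumes scaleC_add_right: "c *\<^sub>C (x + y) = c *\<^sub>C x + c *\<^sub>C y"
    and scaleC_add_left: "(c + d) *\<^sub>C x = c *\<^sub>C x + d *\<^sub>C x"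
    and scaleC_scaleC: "c *\<^sub>C (d *\<^sub>C x) = (c * d) *\<^sub>C x"
    and scaleC_of_real: "complex_of_real r *\<^sub>C x = r *\<^sub>R x"
    and mult_scaleC_left: "(c *\<^sub>C x) * y = c *\<^sub>C (x * y)"
    and mult_scaleC_right: "x * (c *\<^sub>C y) = c *\<^sub>C (x * y)"
    and norm_scaleC: "norm (c *\<^sub>C x) = cmod c * norm x"

global_interpretation complex_vector:
  vector_space "scaleC :: complex \<Rightarrow> 'a \<Rightarrow> 'a::complex_banach_algebra"
proof
  fix x :: 'a
  show "1 *\<^sub>C x = x"
    using scaleC_of_real[of 1 x] by simp
qed (simp_all add: scaleC_add_right scaleC_add_left scaleC_scaleC)


section \<open>Ideals, primitivity and the socle\<close>

definition left_ideal :: "'a::complex_banach_algebra set \<Rightarrow> bool" where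
  "left_ideal L \<longleftrightarrow> complex_vector.subspace L \<and> (\<forall>a. \<forall>x\<in>L. a * x \<in> L)"

definition maximal_left_ideal :: "'a::complex_banach_algebra set \<Rightarrow> bool" where
  "maximal_left_ideal L \<longleftrightarrow>
     left_ideal L \<and> L \<noteq> UNIV \<and> (\<forall>M. left_ideal M \<longrightarrow> L \<subseteq> M \<longrightarrow> M = L \<or> M = UNIV)"

definition minimal_left_ideal :: "'a::complex_banach_algebra set \<Rightarrow> bool" where
  "minimal_left_ideal L \<longleftrightarrow>
     left_ideal L \<and> L \<noteq> {0} \<and> (\<forall>M. left_ideal M \<longrightarrow> M \<subseteq> L \<longrightarrow> M = {0} \<or> M = L)"

text \<open>A primitive ideal is the quotient \<open>{a. aA \<subseteq> L}\<close> of a maximal modular left ideal \<open>L\<close>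
  (equivalently, the annihilator of the simple left module \<open>A/L\<close>).  Modularity of \<open>L\<close> is
  automatic because the algebra is unital.\<close>

definition primitive_ideal :: "'a::complex_banach_algebra set \<Rightarrow> bool" where
  "primitive_ideal P \<longleftrightarrow> (\<exists>L. maximal_left_ideal L \<and> P = {a. \<forall>x. a * x \<in> L})"

text \<open>The socle is the sum of all minimal left ideals, hence \<open>{0}\<close> if there are none.\<close>

definition socle :: "'a::complex_banach_algebra set" where
  "socle = complex_vector.span (\<Union>{L. minimal_left_ideal L})"

definition minimal_idempotent :: "'a::complex_banach_algebra \<Rightarrow> bool" where
  "minimal_idempotent p \<longleftrightarrow>
     p \<noteq> 0 \<and> p * p = p \<and> range (\<lambda>x. p * x * p) = range (\<lambda>c. c *\<^sub>C p)"


section \<open>Drazin invertibility and B-Fredholm elements\<close>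

definition drazin_invertible :: "('b, 'm) ring_scheme \<Rightarrow> 'b \<Rightarrow> bool" where
  "drazin_invertible R x \<longleftrightarrow> x \<in> carrier R \<and>
     (\<exists>y\<in>carrier R. \<exists>k::nat.
        y \<otimes>\<^bsub>R\<^esub> x \<otimes>\<^bsub>R\<^esub> y = y \<and>
        x \<otimes>\<^bsub>R\<^esub> y = y \<otimes>\<^bsub>R\<^esub> x \<and>
        x [^]\<^bsub>R\<^esub> k \<otimes>\<^bsub>R\<^esub> y \<otimes>\<^bsub>R\<^esub> x = x [^]\<^bsub>R\<^esub> k)"

definition b_fredholm_element :: "'a::complex_banach_algebra \<Rightarrow> bool" where
  "b_fredholm_element a \<longleftrightarrow>
     drazin_invertible (ring_of_type_algebra Quot socle) (socle +>\<^bsub>ring_of_type_algebra\<^esub> a)"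


section \<open>Bounded operators on a subspace\<close>

text \<open>A bounded operator on a subspace \<open>V\<close> is represented by a function that is
  \<^const>\<open>undefined\<close> outside \<open>V\<close>, so that equality of functions is equality of operators.\<close>

definition bounded_operators :: "'a::complex_banach_algebra set \<Rightarrow> ('a \<Rightarrow> 'a) set" where
  "bounded_operators V = {T \<in> V \<rightarrow>\<^sub>E V.
     (\<forall>x\<in>V. \<forall>y\<in>V. T (x + y) = T x + T y) \<and>
     (\<forall>c. \<forall>x\<in>V. T (c *\<^sub>C x) = c *\<^sub>C T x) \<and>
     (\<exists>K. \<forall>x\<in>V. norm (T x) \<le> K * norm x)}"

definition operator_algebra :: "'a::complex_banach_algebra set \<Rightarrow> ('a \<Rightarrow> 'a) ring" where
  "operator_algebra V =
     \<lparr>carrier = bounded_operators V, mult = compose V, one = (\<lambda>x\<in>V. x),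
      zero = (\<lambda>x\<in>V. 0), add = (\<lambda>S T. \<lambda>x\<in>V. S x + T x)\<rparr>"

definition finite_dimensional :: "'a::complex_banach_algebra set \<Rightarrow> bool" where
  "finite_dimensional V \<longleftrightarrow> (\<exists>B. finite B \<and> V \<subseteq> complex_vector.span B)"

definition finite_rank_operators :: "'a::complex_banach_algebra set \<Rightarrow> ('a \<Rightarrow> 'a) set" where
  "finite_rank_operators V = {T \<in> bounded_operators V. finite_dimensional (T ` V)}"

text \<open>Finite-dimensional kernel and range of finite codimension in \<open>V\<close>.\<close>

definition fredholm_operator :: "'a::complex_banach_algebra set \<Rightarrow> ('a \<Rightarrow> 'a) \<Rightarrow> bool" where
  "fredholm_operator V T \<longleftrightarrow> T \<in> bounded_operators V \<and>
     finite_dimensional {x\<in>V. T x = 0} \<and>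
     (\<exists>B. finite B \<and> B \<subseteq> V \<and> V = complex_vector.span (T ` V \<union> B))"

definition b_fredholm_operator :: "'a::complex_banach_algebra set \<Rightarrow> ('a \<Rightarrow> 'a) \<Rightarrow> bool" where
  "b_fredholm_operator V T \<longleftrightarrow> T \<in> bounded_operators V \<and>
     (\<exists>n. closedin (top_of_set V) ((T ^^ n) ` V) \<and>
          fredholm_operator ((T ^^ n) ` V) (restrict T ((T ^^ n) ` V)))"


section \<open>The left regular representation on \<open>Ap\<close>\<close>

definition principal_left_ideal :: "'a::complex_banach_algebra \<Rightarrow> 'a set" where
  "principal_left_ideal p = range (\<lambda>x. x * p)"

definition left_regular :: "'a::complex_banach_algebra \<Rightarrow> 'a \<Rightarrow> 'a \<Rightarrow> 'a" where
  "left_regular p x = (\<lambda>y\<in>principal_left_ideal p. x * y)"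

definition left_regular_image :: "'a::complex_banach_algebra \<Rightarrow> ('a \<Rightarrow> 'a) ring" where
  "left_regular_image p =
     (operator_algebra (principal_left_ideal p))\<lparr>carrier := range (left_regular p)\<rparr>"

end

theory Submission
  imports Defs
begin

text \<open>
  Put \<open>V = Ap\<close>. Primitivity makes \<open>A\<close> prime, so \<open>\<L>\<^sub>r\<close> is injective and the socle is exactly the
  preimage of \<open>F\<^sub>0(V)\<close>; hence \<open>A/soc(A)\<close> is isomorphic to \<open>\<L>\<^sub>r(A)/F\<^sub>0(V)\<close>, and \<open>a\<close> is a B-Fredholm
  element iff its class is Drazin invertible in \<open>\<L>\<^sub>r(A)/F\<^sub>0(V)\<close>. The equivalence then reduces to
  Berkani's theorem: \<open>T\<close> is a B-Fredholm operator iff it is Drazin invertible modulo \<open>F\<^sub>0(V)\<close>.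

  If \<open>M = R(T\<^sup>n)\<close> is closed and \<open>T\<close> is Fredholm on \<open>M\<close> with parametrix \<open>G\<close>, then \<open>G\<^sup>n\<^sup>+\<^sup>1 T\<^sup>n\<close> is a
  Drazin inverse of \<open>T\<close> modulo finite rank. Conversely, if \<open>S\<close> is a Drazin inverse of \<open>T\<close> of index \<open>k\<close>
  modulo finite rank, then \<open>T\<^sup>k S\<^sup>k T\<^sup>k - T\<^sup>k\<close> has finite rank, which forces \<open>R(T\<^sup>k)\<close> to be closed, and
  \<open>S\<close> inverts \<open>T\<close> on \<open>R(T\<^sup>k)\<close> up to finite rank.
\<close>

section \<open>Open mappings between closed subspaces\<close>

text \<open>The Baire category theorem inside the complete space \<open>Y\<close>: if every
  \<open>Y \<inter> F n\<close> had empty interior relative to \<open>Y\<close>, so would their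
  union, which is \<open>Y\<close> itself and contains \<open>y0\<close>. The ball found is
  accordingly a ball relative to \<open>Y\<close>.\<close>

lemma Baire_closed_Union:
  fixes Y :: "'a::banach set" and F :: "nat \<Rightarrow> 'a set"
  assumes "closed Y" "y0 \<in> Y" "\<And>n. closed (F n)" "Y \<subseteq> (\<Union>n. F n)"
  obtains n y r where "y \<in> Y" "r > 0" "Y \<inter> ball y r \<subseteq> F n"
proof -
  let ?X = "top_of_set Y"
  let ?G = "range (\<lambda>n. Y \<inter> F n)"
  have "completely_metrizable_space ?X"
    by (simp add: assms(1) completely_metrizable_space_closedin completely_metrizable_space_euclidean)
  moreover have "closedin ?X T" if "T \<in> ?G" for T
    using that assms(3) by (auto intro: closedin_closed_Int)
  ultimately have "?X interior_of \<Union>?G = {}" if "\<And>T. T \<in> ?G \<Longrightarrow> ?X interior_of T = {}"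
    using that by (intro Baire_category_alt) auto
  moreover have "\<Union>?G = Y" using assms(4) by auto
  moreover have "?X interior_of Y = Y"
    using interior_of_topspace[of ?X] by simp
  ultimately obtain n where "?X interior_of (Y \<inter> F n) \<noteq> {}" using assms(2) by auto
  then obtain y U where U: "openin ?X U" "y \<in> U" "U \<subseteq> Y \<inter> F n"
    by (auto simp: interior_of_def)
  then obtain r where "r > 0" "ball y r \<inter> Y \<subseteq> U"
    by (auto simp: openin_contains_ball)
  with U show ?thesis by (intro that[of y r n]) auto
qed

text \<open>First half of the open mapping theorem. By Baire, the closure of the image of some ball
  of \<open>W\<close> contains a relative ball of \<open>Y\<close>; subtracting the centre and
  rescaling carries this to every \<open>y\<close>. Passing to closures costs exactness, so a
  preimage is obtained only up to an error of half the norm.\<close>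

lemma open_mapping_approx:
  fixes f :: "'a::real_normed_vector \<Rightarrow> 'b::banach"
  assumes W: "subspace W" and Y: "subspace Y" "closed Y"
    and add: "\<And>x y. x \<in> W \<Longrightarrow> y \<in> W \<Longrightarrow> f (x + y) = f x + f y"
    and scale: "\<And>c x. x \<in> W \<Longrightarrow> f (c *\<^sub>R x) = c *\<^sub>R f x"
    and onto: "f ` W = Y"
  obtains L where "L > 0" "\<And>y. y \<in> Y \<Longrightarrow> \<exists>x\<in>W. norm x \<le> L * norm y \<and> norm (y - f x) \<le> norm y / 2"
proof -
  let ?F = "\<lambda>n::nat. closure (f ` (W \<inter> cball 0 (real n)))"
  have "Y \<subseteq> (\<Union>n. ?F n)"
  proof
    fix y assume "y \<in> Y"
    then obtain x where x: "x \<in> W" "f x = y" using onto by auto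
    obtain n where "norm x \<le> real n" using real_arch_simple by blast
    with x have "y \<in> f ` (W \<inter> cball 0 (real n))" by auto
    then show "y \<in> (\<Union>n. ?F n)" by (intro UN_I[of n] closure_subset[THEN subsetD]) simp_all
  qed
  then obtain n y0 r where y0: "y0 \<in> Y" "r > 0" "Y \<inter> ball y0 r \<subseteq> ?F n"
    using Baire_closed_Union[OF Y(2) subspace_0[OF Y(1)], of ?F] closed_closure by metis
  have approx: "\<exists>x\<in>W. norm x \<le> real n \<and> norm (z - f x) < e" if "z \<in> Y" "dist y0 z < r" "e > 0" for z e
  proof -
    have "z \<in> ?F n" using that y0 by auto
    then show ?thesis using that(3) by (fastforce simp: closure_approachable dist_norm norm_minus_commute)
  qed
  \<comment> \<open>Below, \<open>y\<close> is scaled by \<open>c\<close> to length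
    \<open>r / 2\<close>, which keeps \<open>y0 + c *\<^sub>R y\<close> in the ball. The approximate
    preimages \<open>a\<close> of that point and \<open>b\<close> of \<open>y0\<close> satisfy
    \<open>norm (a - b) \<le> 2 * (real n + 1)\<close>, and division by \<open>c\<close> yields
    exactly \<open>L * norm y\<close>. The two errors \<open>r / 8\<close> add up to
    \<open>r / 4\<close>, which division by \<open>c\<close> turns into \<open>norm y / 2\<close>.
    The summand 1 keeps \<open>L\<close> positive when \<open>n = 0\<close>.\<close>
  define L where "L = 4 * (real n + 1) / r"
  have "L > 0" using y0 by (simp add: L_def)
  moreover have "\<exists>x\<in>W. norm x \<le> L * norm y \<and> norm (y - f x) \<le> norm y / 2" if "y \<in> Y" for y
  proof (cases "y = 0")
    case True
    then show ?thesis using subspace_0[OF W] scale[of 0 0] by (intro bexI[of _ 0]) auto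
  next
    case False
    define c where "c = r / (2 * norm y)"
    have c: "c > 0" using False y0 by (simp add: c_def)
    have "norm (c *\<^sub>R y) = r / 2" using False y0(2) by (simp add: c_def)
    moreover have "y0 + c *\<^sub>R y \<in> Y"
      using y0 that Y(1) by (simp add: subspace_add subspace_scale)
    ultimately obtain a where a: "a \<in> W" "norm a \<le> real n" "norm (y0 + c *\<^sub>R y - f a) < r / 8"
      using approx[of "y0 + c *\<^sub>R y" "r/8"] y0(2) by (auto simp: dist_norm)
    obtain b where b: "b \<in> W" "norm b \<le> real n" "norm (y0 - f b) < r / 8"
      using approx[of y0 "r/8"] y0 by auto
    define x where "x = (1 / c) *\<^sub>R (a - b)"
    have fab: "f (a - b) = f a - f b"
      using add[of "a - b" b] a b W by (simp add: subspace_diff)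
    have x: "x \<in> W" using a b W by (simp add: x_def subspace_scale subspace_diff)
    have ab: "norm (a - b) \<le> 2 * (real n + 1)" by (rule order_trans[OF norm_triangle_ineq4]) (use a(2) b(2) in simp)
    have "norm x \<le> L * norm y"
    proof -
      have "norm x = norm (a - b) / c" using c by (simp add: x_def)
      also have "\<dots> \<le> 2 * (real n + 1) / c"
        using ab c by (intro divide_right_mono) auto
      also have "\<dots> = L * norm y" using y0(2) False by (simp add: L_def c_def)
      finally show ?thesis .
    qed
    moreover have "norm (y - f x) \<le> norm y / 2"
    proof -
      have "f x = (1 / c) *\<^sub>R (f a - f b)"
        using scale[of "a - b" "1 / c"] a b W by (simp only: x_def subspace_diff fab)
      then have "y - f x = (1 / c) *\<^sub>R ((y0 + c *\<^sub>R y - f a) - (y0 - f b))"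
        using c by (simp add: scaleR_add_right scaleR_diff_right)
      then have "norm (y - f x) = (1 / c) * norm ((y0 + c *\<^sub>R y - f a) - (y0 - f b))"
        using c by (simp only: norm_scaleR) simp
      also have "\<dots> \<le> (1 / c) * (r / 4)"
        using c norm_triangle_ineq4[of "y0 + c *\<^sub>R y - f a" "y0 - f b"] a(3) b(3)
        by (intro mult_left_mono) (linarith, simp)
      also have "\<dots> = norm y / 2" using y0(2) False by (simp add: c_def)
      finally show ?thesis .
    qed
    ultimately show ?thesis using x by blast
  qed
  ultimately show ?thesis using that by blast
qed

text \<open>Second half of the open mapping theorem: the approximate solution is applied repeatedly
  to the residual. Residuals and corrections decay like powers of 1/2, so the corrections sum to an
  exact preimage in the closed set \<open>W\<close>, with the geometric series contributing the
  factor 2 in the constant. Scalars are real because the domain will be a product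
  \<open>M' \<times> F\<close> in the real Banach space of pairs.\<close>

theorem open_mapping_subspace:
  fixes f :: "'a::banach \<Rightarrow> 'b::banach"
  assumes W: "subspace W" "closed W" and Y: "subspace Y" "closed Y"
    and add: "\<And>x y. x \<in> W \<Longrightarrow> y \<in> W \<Longrightarrow> f (x + y) = f x + f y"
    and scale: "\<And>c x. x \<in> W \<Longrightarrow> f (c *\<^sub>R x) = c *\<^sub>R f x"
    and bounded: "\<And>x. x \<in> W \<Longrightarrow> norm (f x) \<le> K * norm x"
    and onto: "f ` W = Y"
  obtains C where "C > 0" "\<And>y. y \<in> Y \<Longrightarrow> \<exists>x\<in>W. f x = y \<and> norm x \<le> C * norm y"
proof -
  obtain L where L: "L > 0"
    "\<And>y. y \<in> Y \<Longrightarrow> \<exists>x\<in>W. norm x \<le> L * norm y \<and> norm (y - f x) \<le> norm y / 2"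
    using open_mapping_approx[of W Y f] assms by blast
  then obtain g where g: "\<And>y. y \<in> Y \<Longrightarrow> g y \<in> W \<and> norm (g y) \<le> L * norm y \<and> norm (y - f (g y)) \<le> norm y / 2"
    by metis
  have "\<exists>x\<in>W. f x = y \<and> norm x \<le> (2 * L) * norm y" if y: "y \<in> Y" for y
  proof -
    \<comment> \<open>\<open>r j\<close> is the residual left after \<open>j\<close> corrections;
      the partial sum of the corrections is therefore mapped to \<open>y - r j\<close>.\<close>
    define r where "r j = ((\<lambda>z. z - f (g z)) ^^ j) y" for j
    have r_Suc: "r (Suc j) = r j - f (g (r j))" for j by (simp add: r_def)
    have fY: "f z \<in> Y" if "z \<in> W" for z using that onto by blast
    have rY: "r j \<in> Y" for j
    proof (induction j)
      case (Suc j)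
      then show ?case using g[OF Suc] fY Y(1) by (simp add: r_Suc subspace_diff)
    qed (simp add: r_def y)
    have r_le: "norm (r j) \<le> norm y * (1/2) ^ j" for j
    proof (induction j)
      case (Suc j)
      then show ?case using g[OF rY[of j]] by (simp add: r_Suc)
    qed (simp add: r_def)
    have g_le: "norm (g (r j)) \<le> L * norm y * (1/2) ^ j" for j
    proof -
      have "norm (g (r j)) \<le> L * norm (r j)" using g[OF rY] by blast
      also have "\<dots> \<le> L * (norm y * (1/2) ^ j)" using r_le L(1) by (intro mult_left_mono) auto
      finally show ?thesis by (simp add: mult.assoc)
    qed
    have sums: "(\<lambda>j. L * norm y * (1/2) ^ j) sums (L * norm y * 2)"
      using sums_mult[OF geometric_sums[of "1/2 :: real"], of "L * norm y"] by simp
    have summ: "summable (\<lambda>j. norm (g (r j)))"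
      by (rule summable_comparison_test'[OF sums_summable[OF sums], of 0]) (simp add: g_le)
    define x where "x = (\<Sum>j. g (r j))"
    define s where "s = (\<lambda>n. \<Sum>j<n. g (r j))"
    have s_lim: "s \<longlonglongrightarrow> x"
      using summable_norm_cancel[OF summ] unfolding s_def x_def by (rule summable_LIMSEQ)
    have sW: "s n \<in> W" for n
      unfolding s_def by (intro subspace_sum W) (use g rY in auto)
    have x: "x \<in> W" using closed_sequentially[OF W(2)] sW s_lim by blast
    have "norm x \<le> (\<Sum>j. norm (g (r j)))" unfolding x_def by (rule summable_norm[OF summ])
    also have "\<dots> \<le> L * norm y * 2"
      unfolding sums_unique[OF sums] by (rule suminf_le[OF g_le summ sums_summable[OF sums]])
    finally have x_le: "norm x \<le> (2 * L) * norm y" by (simp add: mult_ac)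
    have fs: "f (s n) = y - r n" for n
    proof (induction n)
      case 0
      then show ?case using scale[of 0 0] subspace_0[OF W(1)] by (simp add: s_def r_def)
    next
      case (Suc n)
      have "g (r n) \<in> W" using g[OF rY] by blast
      then have "f (s n + g (r n)) = f (s n) + f (g (r n))" by (rule add[OF sW])
      moreover have "s (Suc n) = s n + g (r n)" by (simp add: s_def)
      ultimately show ?case using Suc by (simp only: r_Suc) simp
    qed
    have "r \<longlonglongrightarrow> 0"
    proof (rule Lim_null_comparison)
      show "\<forall>\<^sub>F n in sequentially. norm (r n) \<le> norm y * (1/2) ^ n" by (intro always_eventually allI r_le)
      show "(\<lambda>n. norm y * (1/2) ^ n) \<longlonglongrightarrow> 0"
        by (intro tendsto_mult_right_zero LIMSEQ_power_zero) simp
    qed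
    then have "(\<lambda>n. y - r n) \<longlonglongrightarrow> y - 0" by (intro tendsto_intros)
    then have "(\<lambda>n. f (s n)) \<longlonglongrightarrow> y" using fs by simp
    moreover have "(\<lambda>n. f (s n)) \<longlonglongrightarrow> f x"
    proof -
      have "(\<lambda>n. f (s n) - f x) \<longlonglongrightarrow> 0"
      proof (rule Lim_null_comparison)
        have sx: "s n - x \<in> W" for n using sW x W(1) by (simp add: subspace_diff)
        have "f (s n) - f x = f (s n - x)" for n
          using add[OF sx x, of n] by simp
        then have "norm (f (s n) - f x) \<le> K * norm (s n - x)" for n
          using bounded[OF sx] by simp
        then show "\<forall>\<^sub>F n in sequentially. norm (f (s n) - f x) \<le> K * norm (s n - x)"
          by (intro always_eventually allI)
        have "(\<lambda>n. K * norm (s n - x)) \<longlonglongrightarrow> K * norm (x - x)"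
          by (intro tendsto_intros s_lim)
        then show "(\<lambda>n. K * norm (s n - x)) \<longlonglongrightarrow> 0" by simp
      qed
      then show ?thesis by (rule LIM_zero_cancel)
    qed
    ultimately have "f x = y" using LIMSEQ_unique by blast
    with x x_le show ?thesis by blast
  qed
  then show ?thesis using that[of "2 * L"] L(1) by simp
qed

section \<open>Drazin invertibility in quotient rings\<close>

lemma ring_of_type_algebra_ring: "ring (ring_of_type_algebra :: 'a::ring_1 ring)"
proof -
  have "\<exists>y. x + y = 0" for x :: 'a
    using add.right_inverse by blast
  then show ?thesis
    unfolding ring_of_type_algebra_def using add.right_inverse
    by unfold_locales (auto simp: algebra_simps Units_def)
qed

lemma (in ideal) rcos_eq_iff:
  assumes "x \<in> carrier R" "y \<in> carrier R"
  shows "I +> x = I +> y \<longleftrightarrow> x \<ominus> y \<in> I"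
  using quotient_eq_iff_same_a_r_cos[OF ideal_axioms] assms by blast

text \<open>The projection onto the quotient is a surjective homomorphism, so each defining equation
  between cosets becomes membership of a difference in \<open>I\<close>. In this form Drazin
  invertibility can be compared across different rings without handling cosets.\<close>

lemma (in ideal) drazin_invertible_Quot_iff:
  assumes x: "x \<in> carrier R"
  shows "drazin_invertible (R Quot I) (I +> x) \<longleftrightarrow>
    (\<exists>y\<in>carrier R. \<exists>k::nat. y \<otimes> x \<otimes> y \<ominus> y \<in> I \<and> x \<otimes> y \<ominus> y \<otimes> x \<in> I \<and>
       x [^] k \<otimes> y \<otimes> x \<ominus> x [^] k \<in> I)"
proof -
  interpret q: ring_hom_ring R "R Quot I" "(+>) I" by (rule rcos_ring_hom_ring)
  have carrier: "carrier (R Quot I) = (+>) I ` carrier R"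
    unfolding FactRing_def A_RCOSETS_def' by auto
  have "((I +> y) \<otimes>\<^bsub>R Quot I\<^esub> (I +> x) \<otimes>\<^bsub>R Quot I\<^esub> (I +> y) = I +> y) \<longleftrightarrow> y \<otimes> x \<otimes> y \<ominus> y \<in> I"
    "((I +> x) \<otimes>\<^bsub>R Quot I\<^esub> (I +> y) = (I +> y) \<otimes>\<^bsub>R Quot I\<^esub> (I +> x)) \<longleftrightarrow> x \<otimes> y \<ominus> y \<otimes> x \<in> I"
    "((I +> x) [^]\<^bsub>R Quot I\<^esub> k \<otimes>\<^bsub>R Quot I\<^esub> (I +> y) \<otimes>\<^bsub>R Quot I\<^esub> (I +> x) = (I +> x) [^]\<^bsub>R Quot I\<^esub> k)
       \<longleftrightarrow> x [^] k \<otimes> y \<otimes> x \<ominus> x [^] k \<in> I"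
    if "y \<in> carrier R" for y and k :: nat
    using x that
    by (simp_all only: q.hom_mult[symmetric] q.hom_nat_pow[symmetric] rcos_eq_iff m_closed nat_pow_closed)
  with x show ?thesis
    unfolding drazin_invertible_def carrier by auto
qed

text \<open>Since \<open>h\<close> is onto and \<open>I\<close> is the preimage of \<open>J\<close>,
  it induces an isomorphism of the quotients. Rather than constructing that isomorphism, the proof
  transports the difference conditions: \<open>h y\<close> and \<open>h z\<close> differ by an
  element of \<open>J\<close> exactly when \<open>y\<close> and \<open>z\<close> differ by an
  element of \<open>I\<close>.\<close>

lemma drazin_invertible_Quot_hom:
  assumes hom: "ring_hom_ring R S h" and surj: "h ` carrier R = carrier S"
    and I: "ideal I R" and J: "ideal J S"
    and preimage: "\<And>x. x \<in> carrier R \<Longrightarrow> h x \<in> J \<longleftrightarrow> x \<in> I"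
    and x: "x \<in> carrier R"
  shows "drazin_invertible (S Quot J) (J +>\<^bsub>S\<^esub> h x) \<longleftrightarrow> drazin_invertible (R Quot I) (I +>\<^bsub>R\<^esub> x)"
proof -
  interpret h: ring_hom_ring R S h by (rule hom)
  have minus: "h y \<ominus>\<^bsub>S\<^esub> h z \<in> J \<longleftrightarrow> y \<ominus>\<^bsub>R\<^esub> z \<in> I" if "y \<in> carrier R" "z \<in> carrier R" for y z
    using preimage[of "y \<ominus>\<^bsub>R\<^esub> z"] that by (simp add: a_minus_def)
  show ?thesis
    unfolding ideal.drazin_invertible_Quot_iff[OF I x] ideal.drazin_invertible_Quot_iff[OF J h.hom_closed[OF x]]
    unfolding surj[symmetric]
    using x by (simp flip: h.hom_mult h.hom_nat_pow add: minus)
qed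

text \<open>A coset depends on the addition but not on the carrier. Hence the cosets formed in
  \<open>left_regular_image p\<close> and in the full operator algebra are the same sets.\<close>

lemma rcos_carrier_update: "I +>\<^bsub>R\<lparr>carrier := H\<rparr>\<^esub> x = I +>\<^bsub>R\<^esub> x"
  by (simp add: a_r_coset_def r_coset_def)

section \<open>Bounded operators modulo finite rank\<close>

abbreviation csubspace :: "'a::complex_banach_algebra set \<Rightarrow> bool" where
  "csubspace \<equiv> complex_vector.subspace"

abbreviation cspan :: "'a::complex_banach_algebra set \<Rightarrow> 'a set" where
  "cspan \<equiv> complex_vector.span"

lemmas csubspace_intros =
  complex_vector.subspace_0 complex_vector.subspace_add complex_vector.subspace_diff
  complex_vector.subspace_neg complex_vector.subspace_scale

lemma csubspace_imp_subspace:
  assumes "csubspace V"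
  shows "subspace V"
proof -
  have "c *\<^sub>R x \<in> V" if "x \<in> V" for c x
    using complex_vector.subspace_scale[OF assms that, of "complex_of_real c"] by (simp add: scaleC_of_real)
  then show ?thesis
    using assms by (simp add: subspace_def complex_vector.subspace_def)
qed

section \<open>Finite-dimensional sets\<close>

lemma finite_dimensional_subset: "finite_dimensional W \<Longrightarrow> V \<subseteq> W \<Longrightarrow> finite_dimensional V"
  by (auto simp: finite_dimensional_def)

lemma finite_dimensional_span: "finite B \<Longrightarrow> finite_dimensional (cspan B)"
  by (auto simp: finite_dimensional_def)

lemma finite_dimensional_zero: "finite_dimensional {0}"
  using finite_dimensional_span[of "{}"] by simp

text \<open>The definition allows spanning vectors outside \<open>F\<close>. A maximal independent
  subset of \<open>F\<close> is finite, being an independent set in the span of a finite set.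
  Spanning vectors inside \<open>F\<close> matter because the operators considered are linear only
  on a subspace.\<close>

lemma finite_dimensional_imp_span:
  assumes "finite_dimensional F"
  obtains B where "finite B" "B \<subseteq> F" "F \<subseteq> cspan B"
proof -
  obtain A where A: "finite A" "F \<subseteq> cspan A" using assms by (auto simp: finite_dimensional_def)
  obtain B where B: "B \<subseteq> F" "complex_vector.independent B" "F \<subseteq> cspan B"
    using complex_vector.maximal_independent_subset by blast
  have "finite B"
    using complex_vector.independent_span_bound[OF A(1) B(2)] A B by auto
  with B that show ?thesis by blast
qed

lemma finite_dimensional_sums:
  assumes "finite_dimensional A" "finite_dimensional B"
  shows "finite_dimensional {a + b |a b. a \<in> A \<and> b \<in> B}"
proof -
  obtain S T where "finite S" "A \<subseteq> cspan S" "finite T" "B \<subseteq> cspan T"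
    using assms by (auto simp: finite_dimensional_def)
  then have "{a + b |a b. a \<in> A \<and> b \<in> B} \<subseteq> cspan (S \<union> T)"
    by (auto simp: complex_vector.span_Un)
  then show ?thesis using \<open>finite S\<close> \<open>finite T\<close> by (auto simp: finite_dimensional_def)
qed

text \<open>The conditions of \<open>bounded_operators\<close> with separate domain and target and
  without extensionality: values outside \<open>V\<close> are arbitrary, so operators may be
  composed with \<open>\<circ>\<close> and iterated with \<open>^^\<close> directly.\<close>

definition operator_on ::
  "'a::complex_banach_algebra set \<Rightarrow> 'a set \<Rightarrow> ('a \<Rightarrow> 'a) \<Rightarrow> bool" where
  "operator_on V W T \<longleftrightarrow> (\<forall>x\<in>V. T x \<in> W) \<and>
     (\<forall>x\<in>V. \<forall>y\<in>V. T (x + y) = T x + T y) \<and>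
     (\<forall>c. \<forall>x\<in>V. T (c *\<^sub>C x) = c *\<^sub>C T x) \<and>
     (\<exists>K. \<forall>x\<in>V. norm (T x) \<le> K * norm x)"

lemma bounded_operators_iff: "T \<in> bounded_operators V \<longleftrightarrow> operator_on V V T \<and> T \<in> extensional V"
  by (auto simp: bounded_operators_def operator_on_def PiE_def)

lemma operator_onD:
  assumes "operator_on V W T"
  shows "x \<in> V \<Longrightarrow> T x \<in> W"
    and "x \<in> V \<Longrightarrow> y \<in> V \<Longrightarrow> T (x + y) = T x + T y"
    and "x \<in> V \<Longrightarrow> T (c *\<^sub>C x) = c *\<^sub>C T x"
  using assms by (auto simp: operator_on_def)

lemma operator_on_bound:
  assumes "operator_on V W T"
  shows "\<exists>K>0. \<forall>x\<in>V. norm (T x) \<le> K * norm x"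
proof -
  obtain K where K: "\<forall>x\<in>V. norm (T x) \<le> K * norm x" using assms unfolding operator_on_def by blast
  have "norm (T x) \<le> max K 1 * norm x" if "x \<in> V" for x
    using K that mult_right_mono[of K "max K 1" "norm x"] by force
  then show ?thesis by (intro exI[of _ "max K 1"]) auto
qed

lemma operator_on_cong:
  assumes "operator_on V W T" "csubspace V" "\<And>x. x \<in> V \<Longrightarrow> S x = T x"
  shows "operator_on V W S"
  using assms unfolding operator_on_def by (simp add: csubspace_intros)

lemma operator_on_mono:
  assumes "operator_on V W T" "V0 \<subseteq> V" "\<And>x. x \<in> V0 \<Longrightarrow> T x \<in> W0"
  shows "operator_on V0 W0 T"
  using assms unfolding operator_on_def by blast

lemma operator_on_zero:
  assumes "csubspace V" "operator_on V W T"
  shows "T 0 = 0"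
  using operator_onD(3)[OF assms(2), of 0 0] complex_vector.subspace_0[OF assms(1)] by simp

lemma operator_on_diff:
  assumes "csubspace V" "operator_on V W T" "x \<in> V" "y \<in> V"
  shows "T (x - y) = T x - T y"
  using operator_onD(2)[OF assms(2), of "x - y" y] assms by (simp add: csubspace_intros)

lemma operator_on_comp:
  assumes "operator_on V W S" "operator_on W U T"
  shows "operator_on V U (T \<circ> S)"
proof -
  obtain K where K: "K > 0" "\<And>x. x \<in> V \<Longrightarrow> norm (S x) \<le> K * norm x" using operator_on_bound[OF assms(1)] by blast
  obtain L where L: "L > 0" "\<And>x. x \<in> W \<Longrightarrow> norm (T x) \<le> L * norm x" using operator_on_bound[OF assms(2)] by blast
  have "norm (T (S x)) \<le> (L * K) * norm x" if "x \<in> V" for x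
  proof -
    have "norm (T (S x)) \<le> L * norm (S x)" using L that operator_onD(1)[OF assms(1)] by simp
    also have "\<dots> \<le> L * (K * norm x)" using K that L by (intro mult_left_mono) auto
    finally show ?thesis by simp
  qed
  then show ?thesis
    using operator_onD[OF assms(1)] operator_onD[OF assms(2)] unfolding operator_on_def by auto
qed

lemma operator_on_id: "V \<subseteq> W \<Longrightarrow> operator_on V W id"
  unfolding operator_on_def by (auto intro!: exI[of _ 1])

lemma operator_on_funpow: "operator_on V V T \<Longrightarrow> operator_on V V (T ^^ n)"
  by (induction n) (auto intro: operator_on_comp operator_on_id)

lemma operator_on_diff_operator:
  assumes "csubspace W" "operator_on V W S" "operator_on V W T"
  shows "operator_on V W (\<lambda>x. S x - T x)"
proof -
  obtain K where K: "K > 0" "\<And>x. x \<in> V \<Longrightarrow> norm (S x) \<le> K * norm x" using operator_on_bound[OF assms(2)] by blast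
  obtain L where L: "L > 0" "\<And>x. x \<in> V \<Longrightarrow> norm (T x) \<le> L * norm x" using operator_on_bound[OF assms(3)] by blast
  have "norm (S x - T x) \<le> (K + L) * norm x" if "x \<in> V" for x
    using norm_triangle_ineq4[of "S x" "T x"] K(2)[OF that] L(2)[OF that] by (simp add: algebra_simps)
  then show ?thesis
    using operator_onD[OF assms(2)] operator_onD[OF assms(3)] assms(1) unfolding operator_on_def
    by (auto simp: csubspace_intros complex_vector.scale_right_diff_distrib)
qed

lemma operator_on_continuous:
  assumes "csubspace V" "operator_on V W T"
  shows "continuous_on V T"
proof -
  obtain K where K: "K > 0" "\<And>x. x \<in> V \<Longrightarrow> norm (T x) \<le> K * norm x" using operator_on_bound[OF assms(2)] by blast
  have "K-lipschitz_on V T"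
    using K assms by (intro lipschitz_onI) (auto simp: dist_norm csubspace_intros simp flip: operator_on_diff)
  then show ?thesis by (rule lipschitz_on_continuous_on)
qed

lemma closed_operator_on_preimage:
  assumes "csubspace V" "closed V" "operator_on V W T" "closed D"
  shows "closed {x\<in>V. T x \<in> D}"
  using continuous_closed_preimage[OF operator_on_continuous[OF assms(1,3)] assms(2,4)]
  by (simp add: vimage_def Int_def)

lemma csubspace_image:
  assumes "csubspace V" "operator_on V W T"
  shows "csubspace (T ` V)"
  unfolding complex_vector.subspace_def
proof safe
  show "0 \<in> T ` V" using operator_on_zero[OF assms] complex_vector.subspace_0[OF assms(1)] by (metis imageI)
next
  fix x y assume "x \<in> V" "y \<in> V"
  then show "T x + T y \<in> T ` V"
    using assms by (intro image_eqI[of _ _ "x + y"]) (auto simp: operator_onD csubspace_intros)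
next
  fix c x assume "x \<in> V"
  then show "c *\<^sub>C T x \<in> T ` V"
    using assms by (intro image_eqI[of _ _ "c *\<^sub>C x"]) (auto simp: operator_onD csubspace_intros)
qed

lemma csubspace_kernel:
  assumes "csubspace V" "operator_on V W T"
  shows "csubspace {x\<in>V. T x = 0}"
  using assms operator_on_zero[OF assms] unfolding complex_vector.subspace_def[of "Collect _"]
  by (auto simp: operator_onD csubspace_intros)

lemma operator_on_span_subset:
  assumes "csubspace V" "operator_on V W T" "B \<subseteq> V"
  shows "T ` cspan B \<subseteq> cspan (T ` B)"
proof -
  \<comment> \<open>Linearity of \<open>T\<close> is available only on \<open>V\<close>, so
    membership in \<open>V\<close> is carried through the induction.\<close>
  have "x \<in> V \<and> T x \<in> cspan (T ` B)" if "x \<in> cspan B" for x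
    using that
  proof (induction rule: complex_vector.span_induct_alt)
    case base
    show ?case using operator_on_zero[OF assms(1,2)] assms(1)
      by (simp add: complex_vector.span_zero csubspace_intros)
  next
    case (step c x y)
    have *: "c *\<^sub>C x \<in> V" "x \<in> V" "y \<in> V" using step assms by (auto simp: csubspace_intros)
    then have "T (c *\<^sub>C x + y) = c *\<^sub>C T x + T y"
      by (simp add: operator_onD(2)[OF assms(2)] operator_onD(3)[OF assms(2)])
    with step * assms(1) show ?case
      by (simp add: csubspace_intros complex_vector.span_add complex_vector.span_scale complex_vector.span_base)
  qed
  then show ?thesis by blast
qed

lemma finite_dimensional_image:
  assumes "csubspace V" "operator_on V W T" "F \<subseteq> V" "finite_dimensional F"
  shows "finite_dimensional (T ` F)"
proof -
  obtain B where B: "finite B" "B \<subseteq> F" "F \<subseteq> cspan B" using finite_dimensional_imp_span[OF assms(4)] .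
  have "T ` F \<subseteq> T ` cspan B" using B by blast
  also have "\<dots> \<subseteq> cspan (T ` B)" using assms(3) B by (intro operator_on_span_subset[OF assms(1,2)]) auto
  finally show ?thesis using B(1) by (auto simp: finite_dimensional_def)
qed

text \<open>Congruence modulo the finite rank operators, stated for plain functions, so that
  calculations need neither restriction to \<open>V\<close> nor the ring operations of
  \<open>operator_algebra\<close>.\<close>

definition almost_equal ::
  "'a::complex_banach_algebra set \<Rightarrow> ('a \<Rightarrow> 'a) \<Rightarrow> ('a \<Rightarrow> 'a) \<Rightarrow> bool" where
  "almost_equal V S T \<longleftrightarrow> finite_dimensional ((\<lambda>x. S x - T x) ` V)"

lemma almost_equal_cong:
  assumes "almost_equal V S T" "\<And>x. x \<in> V \<Longrightarrow> S' x = S x" "\<And>x. x \<in> V \<Longrightarrow> T' x = T x"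
  shows "almost_equal V S' T'"
  using assms unfolding almost_equal_def by (metis (mono_tags, lifting) image_cong)

lemma almost_equal_refl: "(\<And>x. x \<in> V \<Longrightarrow> S x = T x) \<Longrightarrow> almost_equal V S T"
  unfolding almost_equal_def by (rule finite_dimensional_subset[OF finite_dimensional_zero]) auto

lemma almost_equal_sym:
  assumes "almost_equal V S T"
  shows "almost_equal V T S"
proof -
  obtain B where B: "finite B" "(\<lambda>x. S x - T x) ` V \<subseteq> cspan B"
    using assms by (auto simp: almost_equal_def finite_dimensional_def)
  have "T x - S x \<in> cspan B" if "x \<in> V" for x
    using complex_vector.span_neg[of "S x - T x" B] B that by auto
  then show ?thesis using B(1) by (auto simp: almost_equal_def finite_dimensional_def)
qed

lemma almost_equal_trans:
  assumes "almost_equal V R S" "almost_equal V S T"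
  shows "almost_equal V R T"
  unfolding almost_equal_def
proof (rule finite_dimensional_subset[OF finite_dimensional_sums])
  show "finite_dimensional ((\<lambda>x. R x - S x) ` V)" "finite_dimensional ((\<lambda>x. S x - T x) ` V)"
    using assms by (auto simp: almost_equal_def)
  show "(\<lambda>x. R x - T x) ` V \<subseteq>
      {a + b |a b. a \<in> (\<lambda>x. R x - S x) ` V \<and> b \<in> (\<lambda>x. S x - T x) ` V}"
  proof
    fix y assume "y \<in> (\<lambda>x. R x - T x) ` V"
    then obtain x where "x \<in> V" "y = (R x - S x) + (S x - T x)" by auto
    then show "y \<in> {a + b |a b. a \<in> (\<lambda>x. R x - S x) ` V \<and> b \<in> (\<lambda>x. S x - T x) ` V}" by blast
  qed
qed

text \<open>The difference of the composites is \<open>R\<close> applied to the difference of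
  \<open>S\<close> and \<open>T\<close>, and a linear map preserves finite dimension. Together with
  composition on the other side, this is the two-sided ideal property of finite rank
  operators.\<close>

lemma almost_equal_comp_left:
  assumes "almost_equal V S T" "csubspace W" "operator_on W U R"
    "\<And>x. x \<in> V \<Longrightarrow> S x \<in> W" "\<And>x. x \<in> V \<Longrightarrow> T x \<in> W"
  shows "almost_equal V (R \<circ> S) (R \<circ> T)"
proof -
  have "(\<lambda>x. (R \<circ> S) x - (R \<circ> T) x) ` V = R ` (\<lambda>x. S x - T x) ` V"
    unfolding image_image using assms by (intro image_cong) (auto simp: operator_on_diff)
  moreover have "finite_dimensional (R ` (\<lambda>x. S x - T x) ` V)"
    using assms by (intro finite_dimensional_image[OF assms(2,3)]) (auto simp: almost_equal_def csubspace_intros)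
  ultimately show ?thesis by (simp add: almost_equal_def)
qed

lemma almost_equal_comp_right:
  assumes "almost_equal W S T" "\<And>x. x \<in> V \<Longrightarrow> R x \<in> W"
  shows "almost_equal V (S \<circ> R) (T \<circ> R)"
  using assms(1) unfolding almost_equal_def
  by (rule finite_dimensional_subset) (use assms(2) in auto)

text \<open>The innermost factor \<open>S \<circ> T\<close> of
  \<open>S ^^ Suc n \<circ> T ^^ Suc n\<close> cancels modulo finite rank and leaves
  \<open>S ^^ n \<circ> T ^^ n\<close>.\<close>

lemma almost_equal_funpow_inverse:
  assumes "csubspace M" "operator_on M M S" "operator_on M M T" "almost_equal M (S \<circ> T) id"
  shows "almost_equal M (S ^^ n \<circ> T ^^ n) id"
proof (induction n)
  case 0
  show ?case by (rule almost_equal_refl) simp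
next
  case (Suc n)
  have Tn: "T x \<in> M" "(T ^^ n) x \<in> M" "S x \<in> M" if "x \<in> M" for x
    using operator_onD(1)[OF assms(3)] operator_onD(1)[OF operator_on_funpow[OF assms(3)]]
      operator_onD(1)[OF assms(2)] that by auto
  have "almost_equal M (S ^^ n \<circ> ((S \<circ> T) \<circ> T ^^ n)) (S ^^ n \<circ> (id \<circ> T ^^ n))"
    by (intro almost_equal_comp_left[OF _ assms(1) operator_on_funpow[OF assms(2)]]
        almost_equal_comp_right[OF assms(4)]) (auto simp: Tn)
  then have "almost_equal M (S ^^ n \<circ> ((S \<circ> T) \<circ> T ^^ n)) id"
    unfolding id_o by (rule almost_equal_trans[OF _ Suc.IH])
  moreover have "S ^^ Suc n \<circ> T ^^ Suc n = S ^^ n \<circ> ((S \<circ> T) \<circ> T ^^ n)"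
    by (simp only: funpow_Suc_right[of n S] funpow.simps(2)[of n T] o_assoc)
  ultimately show ?case by (simp only:)
qed

section \<open>Parametrices of Fredholm operators\<close>

text \<open>On \<open>Ap\<close> the functionals come from the algebra itself, so this condition takes the place of
  the Hahn-Banach theorem.\<close>

definition separated_by_functionals :: "'a::complex_banach_algebra set \<Rightarrow> bool" where
  "separated_by_functionals V \<longleftrightarrow> (\<forall>v\<in>V. v \<noteq> 0 \<longrightarrow> (\<exists>\<phi>::'a \<Rightarrow> complex.
     (\<forall>x y. \<phi> (x + y) = \<phi> x + \<phi> y) \<and> (\<forall>c x. \<phi> (c *\<^sub>C x) = c * \<phi> x) \<and>
     (\<exists>K. \<forall>x. cmod (\<phi> x) \<le> K * norm x) \<and> \<phi> v \<noteq> 0))"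

text \<open>Vectors are added one at a time. If the residual \<open>b'\<close> of the new vector
  under the old projection is nonzero, a bounded functional that does not vanish at
  \<open>b'\<close> provides a rank-one correction.\<close>

lemma projection_onto_span:
  fixes V :: "'a::complex_banach_algebra set"
  assumes V: "csubspace V" "separated_by_functionals V" and B: "finite B" "B \<subseteq> V"
  shows "\<exists>P. operator_on UNIV (cspan B) P \<and> (\<forall>x\<in>cspan B. P x = x)"
  using B
proof (induction B rule: finite_induct)
  case empty
  have "operator_on UNIV (cspan {}) (\<lambda>_. 0 :: 'a)"
    unfolding operator_on_def by (auto intro!: exI[of _ 0])
  then show ?case by (intro exI[of _ "\<lambda>_. 0"]) auto
next
  case (insert b B)
  then obtain P where P: "operator_on UNIV (cspan B) P" and P_id: "\<And>x. x \<in> cspan B \<Longrightarrow> P x = x" by auto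
  have BV: "cspan B \<subseteq> V" using insert V by (simp add: complex_vector.span_minimal)
  have PB: "P x \<in> cspan B" for x using operator_onD(1)[OF P] by simp
  have P_add: "P (x + y) = P x + P y" for x y using operator_onD(2)[OF P] by simp
  have P_scale: "P (c *\<^sub>C x) = c *\<^sub>C P x" for c x using operator_onD(3)[OF P] by simp
  obtain K where K: "K > 0" "\<And>x. norm (P x) \<le> K * norm x" using operator_on_bound[OF P] by auto
  define b' where "b' = b - P b"
  show ?case
  proof (cases "b' = 0")
    case True
    then have "b \<in> cspan B" using PB[of b] by (simp add: b'_def)
    then have "cspan (insert b B) = cspan B" by (rule complex_vector.span_redundant)
    with P P_id show ?thesis by auto
  next
    case False
    have "b' \<in> V" unfolding b'_def using insert.prems PB[of b] BV
      by (intro complex_vector.subspace_diff[OF V(1)]) auto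
    then obtain \<phi> :: "'a \<Rightarrow> complex" where \<phi>: "\<And>x y. \<phi> (x + y) = \<phi> x + \<phi> y"
      "\<And>c x. \<phi> (c *\<^sub>C x) = c * \<phi> x" "\<exists>L. \<forall>x. cmod (\<phi> x) \<le> L * norm x" "\<phi> b' \<noteq> 0"
      using V(2) False unfolding separated_by_functionals_def by blast
    obtain L where L: "\<And>x. cmod (\<phi> x) \<le> L * norm x" using \<phi>(3) by blast
    have \<phi>_diff: "\<phi> (x - y) = \<phi> x - \<phi> y" for x y using \<phi>(1)[of "x - y" y] by simp
    \<comment> \<open>Because \<phi> is evaluated at \<open>x - P x\<close>, the correction vanishes
      on \<open>cspan B\<close>; at \<open>b\<close> it equals \<open>b'\<close>, so
      \<open>Q b = b\<close>.\<close>
    define Q where "Q x = P x + (\<phi> (x - P x) / \<phi> b') *\<^sub>C b'" for x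
    have Q_add: "Q (x + y) = Q x + Q y" for x y
      by (simp add: Q_def P_add \<phi>(1) \<phi>_diff add_divide_distrib diff_divide_distrib
          scaleC_add_left algebra_simps)
    have Q_scale: "Q (c *\<^sub>C x) = c *\<^sub>C Q x" for c x
      by (simp add: Q_def P_scale \<phi>(2) \<phi>_diff scaleC_add_right scaleC_scaleC algebra_simps diff_divide_distrib)
    have B_sub: "cspan B \<subseteq> cspan (insert b B)" by (intro complex_vector.span_mono) auto
    have b'_in: "b' \<in> cspan (insert b B)"
      unfolding b'_def
      by (intro complex_vector.span_diff) (use B_sub PB[of b] in \<open>auto intro: complex_vector.span_base\<close>)
    have Q_in: "Q x \<in> cspan (insert b B)" for x
      unfolding Q_def
      by (intro complex_vector.span_add complex_vector.span_scale b'_in) (use B_sub PB[of x] in auto)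
    have Q_bound: "norm (Q x) \<le> (K + L * (1 + K) / cmod (\<phi> b') * norm b') * norm x" for x
    proof -
      have L0: "L \<ge> 0"
      proof (rule ccontr)
        assume "\<not> L \<ge> 0"
        then have "L * norm b' < 0" using False by (simp add: mult_neg_pos)
        then show False using L[of b'] norm_ge_zero[of "\<phi> b'"] by linarith
      qed
      have "cmod (\<phi> (x - P x)) \<le> L * norm (x - P x)" by (rule L)
      also have "\<dots> \<le> L * ((1 + K) * norm x)"
        using L0 K(2)[of x] norm_triangle_ineq4[of x "P x"]
        by (intro mult_left_mono) (auto simp: algebra_simps)
      finally have *: "cmod (\<phi> (x - P x)) / cmod (\<phi> b') * norm b'
          \<le> L * ((1 + K) * norm x) / cmod (\<phi> b') * norm b'"
        by (intro mult_right_mono divide_right_mono) auto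
      have "norm (Q x) \<le> norm (P x) + cmod (\<phi> (x - P x)) / cmod (\<phi> b') * norm b'"
        unfolding Q_def by (rule order_trans[OF norm_triangle_ineq]) (simp add: norm_scaleC norm_divide)
      also have "\<dots> \<le> K * norm x + L * ((1 + K) * norm x) / cmod (\<phi> b') * norm b'"
        by (rule add_mono[OF K(2) *])
      also have "\<dots> = (K + L * (1 + K) / cmod (\<phi> b') * norm b') * norm x"
        by (simp add: algebra_simps add_divide_distrib)
      finally show ?thesis .
    qed
    have "operator_on UNIV (cspan (insert b B)) Q"
      unfolding operator_on_def using Q_in Q_add Q_scale Q_bound by blast
    moreover have "Q x = x" if x: "x \<in> cspan (insert b B)" for x
    proof -
      obtain k where k: "x - k *\<^sub>C b \<in> cspan B" using x by (auto simp: complex_vector.span_insert)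
      have "\<phi> 0 = 0" using \<phi>(2)[of 0 0] by simp
      then have "Q (x - k *\<^sub>C b) = x - k *\<^sub>C b" by (simp add: Q_def P_id[OF k])
      moreover have "Q b = b" using \<phi>(4) by (simp add: Q_def flip: b'_def) (simp add: b'_def)
      moreover have "Q x = Q (x - k *\<^sub>C b) + k *\<^sub>C Q b" by (simp flip: Q_add Q_scale)
      ultimately show ?thesis by simp
    qed
    ultimately show ?thesis by blast
  qed
qed

text \<open>\<open>D\<close> is the range of a bounded projection \<open>P\<close>, hence the zero
  set of the continuous map \<open>P - id\<close>.\<close>

lemma closed_finite_dimensional:
  assumes V: "csubspace V" "separated_by_functionals V"
    and D: "csubspace D" "D \<subseteq> V" "finite_dimensional D"
  shows "closed D"
proof -
  obtain B where B: "finite B" "B \<subseteq> D" "D \<subseteq> cspan B" using finite_dimensional_imp_span[OF D(3)] .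
  then have span: "cspan B = D" using D(1) by (meson complex_vector.span_minimal subset_antisym)
  obtain P where P: "operator_on UNIV D P" "\<forall>x\<in>D. P x = x"
    using projection_onto_span[OF V B(1)] B(2) D(2) span by auto
  have "operator_on UNIV UNIV (\<lambda>x. P x - id x)"
    using operator_on_mono[OF P(1)] by (intro operator_on_diff_operator operator_on_id) auto
  then have "closed {x\<in>UNIV. P x - id x \<in> {0}}"
    by (intro closed_operator_on_preimage) auto
  moreover have "{x\<in>UNIV. P x - id x \<in> {0}} = D"
    using P operator_onD(1)[OF P(1)] by (metis (no_types, lifting) Collect_cong Collect_mem_eq UNIV_I
      eq_iff_diff_eq_0 id_apply singleton_iff)
  ultimately show ?thesis by simp
qed

text \<open>Greedy selection: a vector of \<open>B\<close> is kept only if it lies outside the span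
  of \<open>R\<close> and the vectors kept before. The kept vectors then span a direct complement of
  \<open>R\<close>.\<close>

lemma finite_complement_subset:
  assumes "finite B" "csubspace R"
  shows "\<exists>B'\<subseteq>B. cspan (R \<union> B') = cspan (R \<union> B) \<and> R \<inter> cspan B' = {0}"
  using assms(1)
proof (induction B rule: finite_induct)
  case empty
  show ?case using complex_vector.subspace_0[OF assms(2)] by auto
next
  case (insert b B)
  then obtain B' where B': "B' \<subseteq> B" "cspan (R \<union> B') = cspan (R \<union> B)" "R \<inter> cspan B' = {0}" by auto
  show ?case
  proof (cases "b \<in> cspan (R \<union> B')")
    case True
    then have "cspan (R \<union> insert b B) = cspan (R \<union> B)"
      using B'(2) by (simp add: complex_vector.span_redundant)
    with B' show ?thesis by (intro exI[of _ B']) auto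
  next
    case False
    have "x = 0" if x: "x \<in> R" "x \<in> cspan (insert b B')" for x
    proof -
      obtain k where k: "x - k *\<^sub>C b \<in> cspan B'" using x by (auto simp: complex_vector.span_insert)
      have "k = 0"
      proof (rule ccontr)
        assume k0: "k \<noteq> 0"
        have "x \<in> cspan (R \<union> B')" "x - k *\<^sub>C b \<in> cspan (R \<union> B')"
          using x k complex_vector.span_mono[of B' "R \<union> B'"] by (auto intro: complex_vector.span_base)
        then have "x - (x - k *\<^sub>C b) \<in> cspan (R \<union> B')" by (rule complex_vector.span_diff)
        then have "k *\<^sub>C b \<in> cspan (R \<union> B')" by simp
        from complex_vector.span_scale[OF this, of "inverse k"] False k0 show False by simp
      qed
      with k x B' show ?thesis by auto
    qed
    then have "R \<inter> cspan (insert b B') = {0}"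
      using complex_vector.subspace_0[OF assms(2)] complex_vector.span_zero by auto
    moreover have "cspan (R \<union> insert b B') = cspan (R \<union> insert b B)"
      using B'(2) by (simp add: complex_vector.span_insert)
    ultimately show ?thesis using B'(1) by (intro exI[of _ "insert b B'"]) auto
  qed
qed

text \<open>The kernel \<open>E\<close> is split off by a bounded projection \<open>P\<close>, and
  the range is enlarged by a finite-dimensional complement \<open>F\<close>. This turns
  \<open>T\<close> into a bijection with bounded inverse, by the open mapping theorem. The defect of
  \<open>T \<circ> G\<close> then lies in \<open>F\<close> and that of \<open>G \<circ> T\<close> in
  \<open>E\<close>.\<close>

lemma fredholm_parametrix:
  fixes V :: "'a::complex_banach_algebra set"
  assumes V: "csubspace V" "separated_by_functionals V"
    and M: "csubspace M" "closed M" "M \<subseteq> V"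
    and T: "operator_on M M T"
    and ker: "finite_dimensional {x\<in>M. T x = 0}"
    and coker: "finite B" "B \<subseteq> M" "M = cspan (T ` M \<union> B)"
  obtains G where "operator_on M M G" "almost_equal M (T \<circ> G) id" "almost_equal M (G \<circ> T) id"
proof -
  define E where "E = {x\<in>M. T x = 0}"
  have E: "csubspace E" unfolding E_def by (rule csubspace_kernel[OF M(1) T])
  obtain A where A: "finite A" "A \<subseteq> E" "E \<subseteq> cspan A"
    using finite_dimensional_imp_span[OF ker] unfolding E_def .
  have spanA: "cspan A = E" using A E by (meson complex_vector.span_minimal subset_antisym)
  have EM: "E \<subseteq> M" by (auto simp: E_def)
  have "A \<subseteq> V" using A(2) EM M(3) by blast
  then obtain P where P: "operator_on UNIV E P" and P_id: "\<And>x. x \<in> E \<Longrightarrow> P x = x"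
    using projection_onto_span[OF V A(1)] unfolding spanA by blast
  have PE: "P x \<in> E" for x using operator_onD(1)[OF P] by simp
  have PM: "operator_on M UNIV P" by (rule operator_on_mono[OF P]) auto
  have P_diff: "P (x - y) = P x - P y" for x y
    by (rule operator_on_diff[OF complex_vector.subspace_UNIV P]) auto
  define M' where "M' = {x\<in>M. P x = 0}"
  have M': "csubspace M'" "closed M'" "M' \<subseteq> M"
    using csubspace_kernel[OF M(1) PM] closed_operator_on_preimage[OF M(1,2) PM, of "{0}"]
    by (auto simp: M'_def)
  have split: "x - P x \<in> M'" "T (x - P x) = T x" if "x \<in> M" for x
  proof -
    have "P x \<in> M" using PE EM by blast
    then show "x - P x \<in> M'"
      using that M(1) P_id[OF PE] by (simp add: M'_def P_diff complex_vector.subspace_diff)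
    have "T (P x) = 0" using PE[of x] by (simp add: E_def)
    then show "T (x - P x) = T x"
      using operator_on_diff[OF M(1) T that \<open>P x \<in> M\<close>] by simp
  qed
  have R: "csubspace (T ` M)" by (rule csubspace_image[OF M(1) T])
  \<comment> \<open>The vectors spanning the cokernel are thinned out until their span meets the
    range trivially; this is what makes preimages under \<open>f\<close> unique.\<close>
  obtain B' where B': "B' \<subseteq> B" "cspan (T ` M \<union> B') = M" "T ` M \<inter> cspan B' = {0}"
    using finite_complement_subset[OF coker(1) R] coker(3) by auto
  define F where "F = cspan B'"
  have "finite B'" using B'(1) coker(1) finite_subset by blast
  then have F_fd: "finite_dimensional F" by (simp add: F_def finite_dimensional_span)
  have F: "csubspace F" by (simp add: F_def)
  have FM: "F \<subseteq> M" unfolding F_def using B'(1) coker(2) M(1) by (intro complex_vector.span_minimal) auto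
  have F_closed: "closed F" using FM M(3) by (intro closed_finite_dimensional[OF V F _ F_fd]) auto

  have M'M: "m \<in> M" if "m \<in> M'" for m using that M'(3) by blast
  have T_add: "T (x + y) = T x + T y" if "x \<in> M'" "y \<in> M'" for x y
    using operator_onD(2)[OF T M'M[OF that(1)] M'M[OF that(2)]] .
  have T_scale: "T (c *\<^sub>C x) = c *\<^sub>C T x" if "x \<in> M'" for c x
    using operator_onD(3)[OF T M'M[OF that]] .
  txt \<open>\<open>f\<close> is a bounded bijection from \<open>M' \<times> F\<close> to \<open>M\<close>; the parametrix is the first component of its inverse.\<close>
  define f where "f = (\<lambda>z. T (fst z) + snd z)"
  obtain K where K: "K > 0" "\<And>x. x \<in> M \<Longrightarrow> norm (T x) \<le> K * norm x"
    using operator_on_bound[OF T] by blast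
  obtain C where C: "\<And>y. y \<in> M \<Longrightarrow> \<exists>z\<in>M' \<times> F. f z = y \<and> norm z \<le> C * norm y"
  proof (rule open_mapping_subspace[of "M' \<times> F" M f "K + 1"])
    show "subspace (M' \<times> F)"
      using M'(1) F by (intro subspace_Times csubspace_imp_subspace)
    show "closed (M' \<times> F)" using M'(2) F_closed by (rule closed_Times)
    show "subspace M" "closed M" using M by (auto intro: csubspace_imp_subspace)
    show "f (y + z) = f y + f z" if "y \<in> M' \<times> F" "z \<in> M' \<times> F" for y z
      using that by (auto simp: f_def T_add)
    show "f (c *\<^sub>R z) = c *\<^sub>R f z" if "z \<in> M' \<times> F" for c z
      using that T_scale[of "fst z" "complex_of_real c"]
      by (auto simp: f_def scaleC_of_real scaleR_add_right)
    show "norm (f z) \<le> (K + 1) * norm z" if "z \<in> M' \<times> F" for z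
    proof -
      have "norm (f z) \<le> norm (T (fst z)) + norm (snd z)" unfolding f_def by (rule norm_triangle_ineq)
      also have "\<dots> \<le> K * norm (fst z) + norm (snd z)" using K(2)[OF M'M, of "fst z"] that by auto
      also have "\<dots> \<le> K * norm z + norm z"
        using K(1) norm_fst_le[of "fst z" "snd z"] norm_snd_le[of "snd z" "fst z"]
        by (intro add_mono mult_left_mono) auto
      finally show ?thesis by (simp add: algebra_simps)
    qed
    show "f ` (M' \<times> F) = M"
    proof (intro subset_antisym subsetI)
      fix y assume "y \<in> f ` (M' \<times> F)"
      then obtain m e where "m \<in> M" "e \<in> M" "y = T m + e" using M'(3) FM unfolding f_def by fastforce
      then show "y \<in> M" using operator_onD(1)[OF T] M(1) by (simp add: complex_vector.subspace_add)
    next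
      fix y assume "y \<in> M"
      then have "y \<in> cspan (T ` M \<union> B')" using B'(2) by simp
      then obtain x e where "x \<in> M" "e \<in> F" "y = T x + e"
        unfolding complex_vector.span_Un F_def complex_vector.span_eq_iff[THEN iffD2, OF R] by blast
      then have "y = f (x - P x, e)" "(x - P x, e) \<in> M' \<times> F" using split by (auto simp: f_def)
      then show "y \<in> f ` (M' \<times> F)" by blast
    qed
  qed blast
  have "\<exists>m e. m \<in> M' \<and> e \<in> F \<and> T m + e = y \<and> norm m \<le> C * norm y" if y: "y \<in> M" for y
  proof -
    obtain z where "z \<in> M' \<times> F" "f z = y" "norm z \<le> C * norm y" using C[OF y] by blast
    then show ?thesis using norm_fst_le[of "fst z" "snd z"] by (auto simp: f_def intro: order_trans)
  qed
  then obtain G H where GH: "\<And>y. y \<in> M \<Longrightarrow> G y \<in> M'" "\<And>y. y \<in> M \<Longrightarrow> H y \<in> F"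
      "\<And>y. y \<in> M \<Longrightarrow> T (G y) + H y = y" "\<And>y. y \<in> M \<Longrightarrow> norm (G y) \<le> C * norm y"
    by metis
  have unique: "G y = m" if "y \<in> M" "m \<in> M'" "e \<in> F" "T m + e = y" for y m e
  proof -
    have GM: "G y \<in> M" "m \<in> M" using M'M[OF GH(1)[OF that(1)]] M'M[OF that(2)] by auto
    have "T (G y) = y - H y" "T m = y - e"
      using GH(3)[OF that(1)] that(4) by (simp_all add: eq_diff_eq)
    then have "T (G y - m) = e - H y"
      using operator_on_diff[OF M(1) T GM] by simp
    moreover have "G y - m \<in> M" using GM M(1) by (simp add: complex_vector.subspace_diff)
    moreover have "e - H y \<in> F" using GH(2)[OF that(1)] that(3) F by (simp add: complex_vector.subspace_diff)
    ultimately have "T (G y - m) = 0" using B'(3) unfolding F_def by (metis IntI imageI singletonD)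
    then have "P (G y - m) = G y - m" using \<open>G y - m \<in> M\<close> by (intro P_id) (simp add: E_def)
    then show ?thesis using GH(1)[OF that(1)] that(2) by (simp add: M'_def P_diff)
  qed
  have "G (x + y) = G x + G y" if "x \<in> M" "y \<in> M" for x y
  proof (rule unique)
    show "x + y \<in> M" "G x + G y \<in> M'" "H x + H y \<in> F"
      using that GH M(1) M'(1) F by (auto simp: csubspace_intros)
    have "T (G x + G y) + (H x + H y) = (T (G x) + H x) + (T (G y) + H y)"
      using that GH(1) by (simp add: T_add add_ac)
    then show "T (G x + G y) + (H x + H y) = x + y" using that GH by simp
  qed
  moreover have "G (c *\<^sub>C x) = c *\<^sub>C G x" if "x \<in> M" for c x
  proof (rule unique)
    show "c *\<^sub>C x \<in> M" "c *\<^sub>C G x \<in> M'" "c *\<^sub>C H x \<in> F"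
      using that GH M(1) M'(1) F by (auto simp: csubspace_intros)
    have "T (c *\<^sub>C G x) + c *\<^sub>C H x = c *\<^sub>C (T (G x) + H x)"
      using that GH(1) by (simp add: T_scale scaleC_add_right)
    then show "T (c *\<^sub>C G x) + c *\<^sub>C H x = c *\<^sub>C x" using that GH(3) by simp
  qed
  ultimately have "operator_on M M G"
    unfolding operator_on_def by (intro conjI ballI allI exI[of _ C]) (simp_all add: GH M'M)
  moreover have "almost_equal M (T \<circ> G) id"
    unfolding almost_equal_def
  proof (rule finite_dimensional_subset[OF F_fd], safe)
    fix y assume y: "y \<in> M"
    have "T (G y) - y = - H y" using GH(3)[OF y] by (simp add: eq_neg_iff_add_eq_0 algebra_simps)
    then show "(T \<circ> G) y - id y \<in> F" using GH(2)[OF y] F by (simp add: complex_vector.subspace_neg)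
  qed
  moreover have "almost_equal M (G \<circ> T) id"
    unfolding almost_equal_def
  proof (rule finite_dimensional_subset[OF ker[folded E_def]], safe)
    fix x assume x: "x \<in> M"
    have "G (T x) = x - P x"
      using unique[of "T x" "x - P x" 0] split[OF x] x operator_onD(1)[OF T] complex_vector.subspace_0[OF F]
      by simp
    then show "(G \<circ> T) x - id x \<in> E" using PE E by (simp add: complex_vector.subspace_neg)
  qed
  ultimately show ?thesis by (rule that)
qed

section \<open>B-Fredholm operators are the Drazin invertible ones modulo finite rank\<close>

lemma funpow_image_invariant: "T ` V \<subseteq> V \<Longrightarrow> T ` (T ^^ n) ` V \<subseteq> (T ^^ n) ` V"
  by (auto simp: funpow_swap1[symmetric] image_image) (metis funpow_swap1 image_eqI subset_iff)

text \<open>A parametrix \<open>G\<close> of \<open>T\<close> exists only on the range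
  \<open>M\<close>. Precomposing a power of \<open>G\<close> with \<open>T ^^ n\<close> extends it
  to \<open>V\<close>, and the exponent \<open>n\<close> of the range becomes the Drazin
  index.\<close>

theorem fredholm_on_range_imp_drazin_mod_finite_rank:
  fixes V :: "'a::complex_banach_algebra set"
  assumes V: "csubspace V" "separated_by_functionals V"
    and T: "operator_on V V T"
    and M: "M = (T ^^ n) ` V" "closed M"
    and ker: "finite_dimensional {x\<in>M. T x = 0}"
    and coker: "finite B" "B \<subseteq> M" "M = cspan (T ` M \<union> B)"
  shows "\<exists>S. operator_on V V S \<and> almost_equal V (S \<circ> T \<circ> S) S \<and>
    almost_equal V (T \<circ> S) (S \<circ> T) \<and> almost_equal V (T ^^ n \<circ> S \<circ> T) (T ^^ n)"
proof -
  have Tn: "operator_on V V (T ^^ n)" by (rule operator_on_funpow[OF T])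
  have MV: "M \<subseteq> V" unfolding M(1) using operator_onD(1)[OF Tn] by blast
  have Msub: "csubspace M" unfolding M(1) by (rule csubspace_image[OF V(1) Tn])
  have "T ` V \<subseteq> V" using operator_onD(1)[OF T] by blast
  from funpow_image_invariant[OF this, of n] have "T x \<in> M" if "x \<in> M" for x
    using that unfolding M(1) by blast
  then have TM: "operator_on M M T" using operator_on_mono[OF T MV] by blast
  obtain G where G: "operator_on M M G" "almost_equal M (T \<circ> G) id" "almost_equal M (G \<circ> T) id"
    by (rule fredholm_parametrix[OF V Msub M(2) MV TM ker coker])
  have TnVM: "operator_on V M (T ^^ n)" by (rule operator_on_mono[OF Tn]) (auto simp: M(1))
  have TnM: "operator_on M M (T ^^ n)" and Gn: "operator_on M M (G ^^ k)" for k
    by (rule operator_on_funpow TM G(1))+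
  txt \<open>The power \<open>T ^^ n\<close> carries \<open>V\<close> into \<open>M\<close>, which makes the parametrix \<open>G\<close> applicable on all of \<open>V\<close>.\<close>
  define S where "S = G ^^ Suc n \<circ> T ^^ n"
  \<comment> \<open>\<open>E\<close> is the common value of \<open>T \<circ> S\<close> and
    \<open>S \<circ> T\<close> modulo finite rank. Of the \<open>Suc n\<close> factors
    \<open>G\<close> in \<open>S\<close>, one cancels \<open>T\<close> and the other
    \<open>n\<close> remain in \<open>E\<close>. Since \<open>T ^^ n \<circ> G ^^ n\<close> is
    almost the identity on \<open>M\<close>, composing \<open>S\<close> or \<open>T ^^ n\<close>
    with \<open>E\<close> changes them only by finite rank.\<close>
  define E where "E = G ^^ n \<circ> T ^^ n"
  have EVM: "operator_on V M E" unfolding E_def by (rule operator_on_comp[OF TnVM Gn])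
  have SVM: "operator_on V M S" unfolding S_def by (rule operator_on_comp[OF TnVM Gn])
  then have S: "operator_on V V S" using MV operator_onD(1)[OF SVM] by (intro operator_on_mono[OF SVM]) auto
  have inV: "T x \<in> V" "S x \<in> V" "E x \<in> V" "(T ^^ n) x \<in> M" "E x \<in> M" if "x \<in> V" for x
    using operator_onD(1)[OF T that] operator_onD(1)[OF S that] operator_onD(1)[OF EVM that]
      operator_onD(1)[OF TnVM that] MV by auto
  have inM: "T x \<in> M" "G x \<in> M" "(G ^^ n) x \<in> M" "(T ^^ n) x \<in> M" if "x \<in> M" for x
    using operator_onD(1)[OF TM that] operator_onD(1)[OF G(1) that] operator_onD(1)[OF Gn that]
      operator_onD(1)[OF TnM that] by auto
  have TnGn: "almost_equal M (T ^^ n \<circ> G ^^ n) id"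
    by (rule almost_equal_funpow_inverse[OF Msub TM G(1,2)])
  have TS: "almost_equal V (T \<circ> S) E"
  proof -
    have "almost_equal V ((T \<circ> G) \<circ> E) (id \<circ> E)"
      by (rule almost_equal_comp_right[OF G(2)]) (rule inV)
    moreover have "T \<circ> S = (T \<circ> G) \<circ> E" by (simp add: S_def E_def o_assoc)
    ultimately show ?thesis by simp
  qed
  have ST: "almost_equal V (S \<circ> T) E"
  proof -
    have "almost_equal V (G ^^ n \<circ> ((G \<circ> T) \<circ> T ^^ n)) (G ^^ n \<circ> (id \<circ> T ^^ n))"
      by (rule almost_equal_comp_left[OF almost_equal_comp_right[OF G(3)] Msub Gn]) (simp_all add: inV inM)
    moreover have "S \<circ> T = G ^^ n \<circ> ((G \<circ> T) \<circ> T ^^ n)"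
      by (simp add: S_def funpow_Suc_right[of n G] o_assoc funpow_swap1 fun_eq_iff del: funpow.simps)
    ultimately show ?thesis by (simp add: E_def)
  qed
  have "almost_equal V (S \<circ> T \<circ> S) S"
  proof -
    have "almost_equal V (S \<circ> (T \<circ> S)) (S \<circ> E)"
      by (rule almost_equal_comp_left[OF TS V(1) S]) (simp_all add: inV)
    moreover have "almost_equal V (G ^^ Suc n \<circ> ((T ^^ n \<circ> G ^^ n) \<circ> T ^^ n)) (G ^^ Suc n \<circ> (id \<circ> T ^^ n))"
      by (rule almost_equal_comp_left[OF almost_equal_comp_right[OF TnGn] Msub Gn]) (simp_all add: inV inM)
    then have "almost_equal V (S \<circ> E) S" by (simp only: S_def E_def o_assoc id_o o_id)
    ultimately show ?thesis by (metis almost_equal_trans o_assoc)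
  qed
  moreover have "almost_equal V (T \<circ> S) (S \<circ> T)"
    by (rule almost_equal_trans[OF TS almost_equal_sym[OF ST]])
  moreover have "almost_equal V (T ^^ n \<circ> S \<circ> T) (T ^^ n)"
  proof -
    have "almost_equal V (T ^^ n \<circ> (S \<circ> T)) (T ^^ n \<circ> E)"
      by (rule almost_equal_comp_left[OF ST V(1) Tn]) (simp_all add: inV)
    moreover have "almost_equal V ((T ^^ n \<circ> G ^^ n) \<circ> T ^^ n) (id \<circ> T ^^ n)"
      by (rule almost_equal_comp_right[OF TnGn]) (simp add: inV)
    then have "almost_equal V (T ^^ n \<circ> E) (T ^^ n)" by (simp only: E_def o_assoc id_o)
    ultimately show ?thesis by (metis almost_equal_trans o_assoc)
  qed
  ultimately show ?thesis using S by blast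
qed

section \<open>From Drazin invertibility modulo finite rank to closed range and the Fredholm
  property\<close>

lemma almost_equal_commute_funpow:
  assumes V: "csubspace V" and S: "operator_on V V S" and T: "operator_on V V T"
    and comm: "almost_equal V (S \<circ> T) (T \<circ> S)"
  shows "almost_equal V (S \<circ> T ^^ n) (T ^^ n \<circ> S)"
proof (induction n)
  case 0
  show ?case by (simp add: almost_equal_refl)
next
  case (Suc n)
  have inV: "T x \<in> V" "S x \<in> V" if "x \<in> V" for x
    using operator_onD(1)[OF T that] operator_onD(1)[OF S that] by auto
  have "almost_equal V ((S \<circ> T ^^ n) \<circ> T) ((T ^^ n \<circ> S) \<circ> T)"
    by (rule almost_equal_comp_right[OF Suc.IH]) (rule inV)
  moreover have "almost_equal V (T ^^ n \<circ> (S \<circ> T)) (T ^^ n \<circ> (T \<circ> S))"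
    by (rule almost_equal_comp_left[OF comm V operator_on_funpow[OF T]]) (simp_all add: inV)
  ultimately have "almost_equal V ((S \<circ> T ^^ n) \<circ> T) (T ^^ n \<circ> (T \<circ> S))"
    unfolding o_assoc by (rule almost_equal_trans)
  then show ?case by (simp only: funpow_Suc_right o_assoc)
qed

text \<open>Modulo finite rank, \<open>S \<circ> T\<close> commutes with \<open>T\<close>. The inner
  \<open>S \<circ> T\<close> of \<open>T ^^ k \<circ> S ^^ Suc n \<circ> T ^^ Suc n\<close>
  therefore moves to the right end, where the induction hypothesis and \<open>TkST\<close> absorb
  the rest. The exponent \<open>n\<close> runs while \<open>k\<close> stays fixed; the case
  \<open>n = k\<close> makes \<open>S ^^ k\<close> a generalized inverse of
  \<open>T ^^ k\<close>.\<close>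

lemma drazin_mod_finite_rank_imp_generalized_inverse:
  assumes V: "csubspace V" and S: "operator_on V V S" and T: "operator_on V V T"
    and comm: "almost_equal V (T \<circ> S) (S \<circ> T)"
    and TkST: "almost_equal V (T ^^ k \<circ> S \<circ> T) (T ^^ k)"
  shows "almost_equal V (T ^^ k \<circ> S ^^ n \<circ> T ^^ n) (T ^^ k)"
proof (induction n)
  case 0
  show ?case by (simp add: almost_equal_refl)
next
  case (Suc n)
  have ST: "operator_on V V (S \<circ> T)" and TkSn: "operator_on V V (T ^^ k \<circ> S ^^ n)"
    and Tn: "operator_on V V (T ^^ n)"
    by (intro operator_on_comp[of V V] operator_on_funpow S T)+
  have inV: "T x \<in> V" "S x \<in> V" "(T ^^ n) x \<in> V" if "x \<in> V" for x
    using operator_onD(1)[OF T that] operator_onD(1)[OF S that] operator_onD(1)[OF Tn that] by auto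
  have "almost_equal V ((S \<circ> T) \<circ> T) ((T \<circ> S) \<circ> T)"
    by (rule almost_equal_comp_right[OF almost_equal_sym[OF comm]]) (rule inV)
  then have "almost_equal V ((S \<circ> T) \<circ> T) (T \<circ> (S \<circ> T))" by (simp only: o_assoc)
  then have "almost_equal V ((S \<circ> T) \<circ> T ^^ n) (T ^^ n \<circ> (S \<circ> T))"
    by (rule almost_equal_commute_funpow[OF V ST T])
  then have "almost_equal V ((T ^^ k \<circ> S ^^ n) \<circ> ((S \<circ> T) \<circ> T ^^ n))
      ((T ^^ k \<circ> S ^^ n) \<circ> (T ^^ n \<circ> (S \<circ> T)))"
    by (rule almost_equal_comp_left[OF _ V TkSn]) (simp_all add: inV)
  moreover have "(T ^^ k \<circ> S ^^ n) \<circ> ((S \<circ> T) \<circ> T ^^ n) = T ^^ k \<circ> S ^^ Suc n \<circ> T ^^ Suc n"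
    by (simp only: funpow_Suc_right[of n S] funpow.simps(2)[of n T] o_assoc)
  moreover have "almost_equal V ((T ^^ k \<circ> S ^^ n \<circ> T ^^ n) \<circ> (S \<circ> T)) (T ^^ k \<circ> (S \<circ> T))"
    by (rule almost_equal_comp_right[OF Suc.IH]) (simp add: inV)
  ultimately show ?case using TkST by (metis almost_equal_trans o_assoc)
qed

theorem drazin_mod_finite_rank_imp_fredholm_on_range:
  fixes V :: "'a::complex_banach_algebra set"
  assumes V: "csubspace V" "closed V" "separated_by_functionals V"
    and S: "operator_on V V S" and T: "operator_on V V T"
    and comm: "almost_equal V (T \<circ> S) (S \<circ> T)"
    and TkST: "almost_equal V (T ^^ k \<circ> S \<circ> T) (T ^^ k)"
    and M: "M = (T ^^ k) ` V"
  shows "closed M" "finite_dimensional {x\<in>M. T x = 0}"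
    "\<exists>B. finite B \<and> B \<subseteq> M \<and> M = cspan (T ` M \<union> B)"
proof -
  have Tk: "operator_on V V (T ^^ k)" and Sk: "operator_on V V (S ^^ k)" and ST: "operator_on V V (S \<circ> T)"
    and TS: "operator_on V V (T \<circ> S)"
    by (intro operator_on_comp[of V V] operator_on_funpow S T)+
  have MV: "M \<subseteq> V" unfolding M using operator_onD(1)[OF Tk] by blast
  have Msub: "csubspace M" unfolding M by (rule csubspace_image[OF V(1) Tk])
  have inV: "T x \<in> V" "S x \<in> V" "(T ^^ k) x \<in> V" "(T ^^ k) x \<in> M" "(S ^^ k) x \<in> V" if "x \<in> V" for x
    using operator_onD(1)[OF T that] operator_onD(1)[OF S that] operator_onD(1)[OF Tk that]
      operator_onD(1)[OF Sk that] that by (auto simp: M)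
  have "T ` V \<subseteq> V" using inV by blast
  from funpow_image_invariant[OF this, of k] have TM: "T x \<in> M" if "x \<in> M" for x
    using that unfolding M by blast

  show "closed M"
  proof -
    have "almost_equal V (T ^^ k \<circ> S ^^ k \<circ> T ^^ k) (T ^^ k)"
      by (rule drazin_mod_finite_rank_imp_generalized_inverse[OF V(1) S T comm TkST])
    then obtain B where B: "finite B" "\<And>x. x \<in> V \<Longrightarrow> (T ^^ k) ((S ^^ k) ((T ^^ k) x)) - (T ^^ k) x \<in> cspan B"
      unfolding almost_equal_def finite_dimensional_def by auto
    define D where "D = M \<inter> cspan B"
    have "csubspace D" unfolding D_def by (intro complex_vector.subspace_inter Msub complex_vector.subspace_span)
    moreover have "D \<subseteq> V" using MV by (auto simp: D_def)
    moreover have "finite_dimensional D"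
      by (rule finite_dimensional_subset[OF finite_dimensional_span[OF B(1)]]) (auto simp: D_def)
    ultimately have D: "csubspace D" "closed D" using closed_finite_dimensional[OF V(1,3)] by auto
    txt \<open>\<open>S ^^ k\<close> is a generalized inverse of \<open>T ^^ k\<close> modulo finite rank, so membership of \<open>y\<close> in the
      range is detected by the closed condition that \<open>y - T\<^sup>k S\<^sup>k y\<close> lies in the finite-dimensional \<open>D\<close>.\<close>
    define R where "R x = id x - (T ^^ k \<circ> S ^^ k) x" for x
    have "operator_on V V R" unfolding R_def
      by (intro operator_on_diff_operator V(1) operator_on_id operator_on_comp[OF Sk Tk]) simp
    then have "closed {x\<in>V. R x \<in> D}" by (rule closed_operator_on_preimage[OF V(1,2) _ D(2)])
    moreover have "{x\<in>V. R x \<in> D} = M"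
    proof (intro subset_antisym subsetI)
      fix y assume "y \<in> {x\<in>V. R x \<in> D}"
      then have "y \<in> V" "R y \<in> M" by (auto simp: D_def)
      then have "R y + (T ^^ k) ((S ^^ k) y) \<in> M"
        by (intro complex_vector.subspace_add[OF Msub] inV)
      then show "y \<in> M" by (simp add: R_def)
    next
      fix y assume y: "y \<in> M"
      then obtain x where x: "x \<in> V" "y = (T ^^ k) x" by (auto simp: M)
      have "R y = - ((T ^^ k) ((S ^^ k) ((T ^^ k) x)) - (T ^^ k) x)" by (simp add: R_def x)
      then have "R y \<in> cspan B" using B(2)[OF x(1)] by (simp only: complex_vector.span_neg)
      moreover have "R y \<in> M"
        using y MV Msub inV by (auto simp: R_def intro!: complex_vector.subspace_diff)
      ultimately show "y \<in> {x\<in>V. R x \<in> D}" using y MV by (auto simp: D_def)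
    qed
    ultimately show ?thesis by simp
  qed

  show "finite_dimensional {x\<in>M. T x = 0}"
  proof -
    \<comment> \<open>The aim is that \<open>S \<circ> T\<close> is almost the identity on the range
      of \<open>T ^^ k\<close>. If \<open>x = (T ^^ k) z\<close> and \<open>T x = 0\<close>, then
      \<open>x\<close> is itself the value at \<open>z\<close> of the finite rank
      difference.\<close>
    have "almost_equal V ((T \<circ> S) \<circ> T) ((S \<circ> T) \<circ> T)"
      by (rule almost_equal_comp_right[OF comm]) (rule inV)
    then have "almost_equal V ((S \<circ> T) \<circ> T) (T \<circ> (S \<circ> T))"
      unfolding o_assoc by (rule almost_equal_sym)
    then have "almost_equal V ((S \<circ> T) \<circ> T ^^ k) (T ^^ k \<circ> (S \<circ> T))"
      by (rule almost_equal_commute_funpow[OF V(1) ST T])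
    then have "almost_equal V ((S \<circ> T) \<circ> T ^^ k) (T ^^ k)"
      using TkST unfolding o_assoc by (rule almost_equal_trans)
    then have "almost_equal V (T ^^ k) ((S \<circ> T) \<circ> T ^^ k)" by (rule almost_equal_sym)
    then show ?thesis
      unfolding almost_equal_def
    proof (rule finite_dimensional_subset, safe)
      fix x assume x: "x \<in> M" "T x = 0"
      then obtain z where "z \<in> V" "x = (T ^^ k) z" by (auto simp: M)
      then show "x \<in> (\<lambda>x. (T ^^ k) x - ((S \<circ> T) \<circ> T ^^ k) x) ` V"
        using x(2) operator_on_zero[OF V(1) S] by (intro image_eqI[of _ _ z]) auto
    qed
  qed

  show "\<exists>B. finite B \<and> B \<subseteq> M \<and> M = cspan (T ` M \<union> B)"
  proof -
    have "almost_equal V (T ^^ k \<circ> (T \<circ> S)) (T ^^ k \<circ> (S \<circ> T))"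
      by (rule almost_equal_comp_left[OF comm V(1) Tk]) (simp_all add: inV)
    then have "almost_equal V (T ^^ k \<circ> (T \<circ> S)) (T ^^ k)"
      using TkST unfolding o_assoc by (rule almost_equal_trans)
    then have "almost_equal V (T ^^ k) (T ^^ k \<circ> (T \<circ> S))" by (rule almost_equal_sym)
    \<comment> \<open>The spanning vectors are taken among the values of the difference, so that
      they lie in \<open>M\<close>, as \<open>fredholm_operator\<close> demands.\<close>
    then obtain B where B: "finite B" "B \<subseteq> (\<lambda>x. (T ^^ k) x - (T ^^ k \<circ> (T \<circ> S)) x) ` V"
        "(\<lambda>x. (T ^^ k) x - (T ^^ k \<circ> (T \<circ> S)) x) ` V \<subseteq> cspan B"
      unfolding almost_equal_def by (rule finite_dimensional_imp_span)
    have BM: "B \<subseteq> M"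
    proof
      fix b assume "b \<in> B"
      then obtain x where "x \<in> V" "b = (T ^^ k) x - (T ^^ k) (T (S x))" using B(2) by auto
      then show "b \<in> M" by (auto intro!: complex_vector.subspace_diff[OF Msub] inV)
    qed
    have "M \<subseteq> cspan (T ` M \<union> B)"
    proof
      fix y assume "y \<in> M"
      then obtain x where x: "x \<in> V" "y = (T ^^ k) x" by (auto simp: M)
      have "(T ^^ k) (T (S x)) = T ((T ^^ k) (S x))" by (simp add: funpow_swap1)
      then have "(T ^^ k) (T (S x)) \<in> T ` M" using x inV by auto
      then have "(T ^^ k) (T (S x)) \<in> cspan (T ` M \<union> B)" by (intro complex_vector.span_base) simp
      moreover have "(T ^^ k) x - (T ^^ k) (T (S x)) \<in> cspan (T ` M \<union> B)"
        using B(3) x(1) complex_vector.span_mono[of B "T ` M \<union> B"] by auto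
      ultimately have "((T ^^ k) x - (T ^^ k) (T (S x))) + (T ^^ k) (T (S x)) \<in> cspan (T ` M \<union> B)"
        by (intro complex_vector.span_add)
      then show "y \<in> cspan (T ` M \<union> B)" by (simp add: x)
    qed
    moreover have "cspan (T ` M \<union> B) \<subseteq> M"
      using TM BM Msub by (intro complex_vector.span_minimal) auto
    ultimately show ?thesis using B(1) BM by blast
  qed
qed

section \<open>The ring of bounded operators and its ideal of finite rank operators\<close>

lemma operator_algebra_simps:
  "carrier (operator_algebra V) = bounded_operators V"
  "S \<otimes>\<^bsub>operator_algebra V\<^esub> T = compose V S T"
  "S \<oplus>\<^bsub>operator_algebra V\<^esub> T = (\<lambda>x\<in>V. S x + T x)"
  "\<one>\<^bsub>operator_algebra V\<^esub> = (\<lambda>x\<in>V. x)"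
  "\<zero>\<^bsub>operator_algebra V\<^esub> = (\<lambda>x\<in>V. 0)"
  by (simp_all add: operator_algebra_def)

lemma restrict_bounded_operators:
  "csubspace V \<Longrightarrow> operator_on V V T \<Longrightarrow> restrict T V \<in> bounded_operators V"
  by (auto simp: bounded_operators_iff intro: operator_on_cong)

lemma operator_on_zero_operator: "csubspace W \<Longrightarrow> operator_on V W (\<lambda>_. 0)"
  unfolding operator_on_def by (auto simp: csubspace_intros intro!: exI[of _ 0])

lemma operator_on_uminus:
  assumes "csubspace W" "operator_on V W T"
  shows "operator_on V W (\<lambda>x. - T x)"
  using operator_on_diff_operator[OF assms(1) operator_on_zero_operator[OF assms(1)] assms(2)] by simp

lemma operator_on_add_operator:
  assumes "csubspace W" "operator_on V W S" "operator_on V W T"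
  shows "operator_on V W (\<lambda>x. S x + T x)"
  using operator_on_diff_operator[OF assms(1,2) operator_on_uminus[OF assms(1,3)]] by simp

lemma compose_bounded_operators:
  assumes "csubspace V" "S \<in> bounded_operators V" "T \<in> bounded_operators V"
  shows "compose V S T \<in> bounded_operators V"
proof -
  have "restrict (S \<circ> T) V \<in> bounded_operators V"
    using assms by (intro restrict_bounded_operators operator_on_comp[of V V]) (auto simp: bounded_operators_iff)
  then show ?thesis by (simp add: compose_def comp_def)
qed

lemma operator_algebra_ring:
  assumes V: "csubspace V"
  shows "ring (operator_algebra V)"
proof -
  have inV: "T x \<in> V" if "T \<in> bounded_operators V" "x \<in> V" for T x
    using that by (auto simp: bounded_operators_iff dest: operator_onD(1))
  have restr: "restrict T V = T" if "T \<in> bounded_operators V" for T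
    using that by (simp add: bounded_operators_iff extensional_restrict)
  have add: "T (x + y) = T x + T y" if "T \<in> bounded_operators V" "x \<in> V" "y \<in> V" for T x y
    using that by (auto simp: bounded_operators_iff dest: operator_onD(2))
  show ?thesis
  proof (rule ringI)
    show "abelian_group (operator_algebra V)"
    proof (rule abelian_groupI; unfold operator_algebra_simps)
      fix S T R assume *: "S \<in> bounded_operators V" "T \<in> bounded_operators V"
      show "(\<lambda>x\<in>V. S x + T x) \<in> bounded_operators V"
        using * V by (intro restrict_bounded_operators operator_on_add_operator) (auto simp: bounded_operators_iff)
      show "(\<lambda>x\<in>V. S x + T x) = (\<lambda>x\<in>V. T x + S x)" by (simp add: add.commute)
      show "(\<lambda>x\<in>V. (\<lambda>x\<in>V. S x + T x) x + R x) = (\<lambda>x\<in>V. S x + (\<lambda>x\<in>V. T x + R x) x)"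
        by (auto simp: add.assoc intro!: restrict_ext)
    next
      show "(\<lambda>x\<in>V. 0) \<in> bounded_operators V"
        by (intro restrict_bounded_operators V operator_on_zero_operator)
    next
      fix T assume T: "T \<in> bounded_operators V"
      have "(\<lambda>x\<in>V. (\<lambda>x\<in>V. 0) x + T x) = restrict T V" by (auto intro!: restrict_ext)
      then show "(\<lambda>x\<in>V. (\<lambda>x\<in>V. 0) x + T x) = T" using restr[OF T] by simp
      show "\<exists>S\<in>bounded_operators V. (\<lambda>x\<in>V. S x + T x) = (\<lambda>x\<in>V. 0)"
      proof (intro bexI)
        show "(\<lambda>x\<in>V. - T x) \<in> bounded_operators V"
          using T V by (intro restrict_bounded_operators operator_on_uminus) (auto simp: bounded_operators_iff)
      qed (auto intro!: restrict_ext)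
    qed
    show "Group.monoid (operator_algebra V)"
    proof (rule monoidI; unfold operator_algebra_simps)
      fix S T R assume *: "S \<in> bounded_operators V" "T \<in> bounded_operators V" "R \<in> bounded_operators V"
      show "compose V S T \<in> bounded_operators V" by (rule compose_bounded_operators[OF V *(1,2)])
      show "compose V (compose V S T) R = compose V S (compose V T R)"
        using inV[OF *(3)] by (auto simp: compose_def intro!: restrict_ext)
    next
      show "(\<lambda>x\<in>V. x) \<in> bounded_operators V"
        using restrict_bounded_operators[OF V operator_on_id[OF order_refl]] by (simp add: id_def)
    next
      fix T assume T: "T \<in> bounded_operators V"
      have "compose V (\<lambda>x\<in>V. x) T = restrict T V" "compose V T (\<lambda>x\<in>V. x) = restrict T V"
        using inV[OF T] by (auto simp: compose_def intro!: restrict_ext)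
      then show "compose V (\<lambda>x\<in>V. x) T = T" "compose V T (\<lambda>x\<in>V. x) = T" using restr[OF T] by auto
    qed
  next
    fix R S T assume "R \<in> carrier (operator_algebra V)" "S \<in> carrier (operator_algebra V)" "T \<in> carrier (operator_algebra V)"
    then have *: "R \<in> bounded_operators V" "S \<in> bounded_operators V" "T \<in> bounded_operators V"
      by (auto simp: operator_algebra_simps)
    show "(R \<oplus>\<^bsub>operator_algebra V\<^esub> S) \<otimes>\<^bsub>operator_algebra V\<^esub> T =
        R \<otimes>\<^bsub>operator_algebra V\<^esub> T \<oplus>\<^bsub>operator_algebra V\<^esub> S \<otimes>\<^bsub>operator_algebra V\<^esub> T"
      using inV[OF *(3)] unfolding operator_algebra_simps by (auto simp: compose_def intro!: restrict_ext)
    show "T \<otimes>\<^bsub>operator_algebra V\<^esub> (R \<oplus>\<^bsub>operator_algebra V\<^esub> S) =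
        T \<otimes>\<^bsub>operator_algebra V\<^esub> R \<oplus>\<^bsub>operator_algebra V\<^esub> T \<otimes>\<^bsub>operator_algebra V\<^esub> S"
      using inV[OF *(1)] inV[OF *(2)] add[OF *(3)] unfolding operator_algebra_simps
      by (auto simp: compose_def intro!: restrict_ext)
  qed
qed

lemma operator_algebra_a_inv:
  assumes V: "csubspace V" and T: "T \<in> bounded_operators V"
  shows "\<ominus>\<^bsub>operator_algebra V\<^esub> T = (\<lambda>x\<in>V. - T x)"
proof -
  interpret ring "operator_algebra V" by (rule operator_algebra_ring[OF V])
  have "(\<lambda>x\<in>V. - T x) \<in> bounded_operators V"
    using T V by (intro restrict_bounded_operators operator_on_uminus) (auto simp: bounded_operators_iff)
  then show ?thesis
    using T by (intro minus_equality) (auto simp: operator_algebra_simps intro!: restrict_ext)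
qed

lemma operator_algebra_nat_pow:
  assumes V: "csubspace V" and T: "T \<in> bounded_operators V"
  shows "T [^]\<^bsub>operator_algebra V\<^esub> (k::nat) = restrict (T ^^ k) V"
proof (induction k)
  case 0
  show ?case by (simp add: operator_algebra_simps)
next
  case (Suc k)
  have "T x \<in> V" if "x \<in> V" for x
    using T that by (auto simp: bounded_operators_iff dest: operator_onD(1))
  with Suc show ?case
    by (auto simp: operator_algebra_simps compose_def funpow_swap1 intro!: restrict_ext)
qed

text \<open>The bridge between differences in the ring \<open>operator_algebra V\<close> and the
  calculus of \<open>almost_equal\<close>.\<close>

lemma finite_rank_minus_iff:
  assumes V: "csubspace V" and S: "S \<in> bounded_operators V" and T: "T \<in> bounded_operators V"
  shows "S \<ominus>\<^bsub>operator_algebra V\<^esub> T \<in> finite_rank_operators V \<longleftrightarrow> almost_equal V S T"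
proof -
  have "S \<ominus>\<^bsub>operator_algebra V\<^esub> T = (\<lambda>x\<in>V. S x - T x)"
    by (auto simp: a_minus_def operator_algebra_a_inv[OF V T] operator_algebra_simps intro!: restrict_ext)
  moreover have "(\<lambda>x\<in>V. S x - T x) \<in> bounded_operators V"
    using S T V by (intro restrict_bounded_operators operator_on_diff_operator) (auto simp: bounded_operators_iff)
  ultimately show ?thesis by (simp add: finite_rank_operators_def almost_equal_def)
qed

lemma finite_rank_operators_ideal:
  assumes V: "csubspace V"
  shows "ideal (finite_rank_operators V) (operator_algebra V)"
proof -
  interpret ring "operator_algebra V" by (rule operator_algebra_ring[OF V])
  have zero: "(\<lambda>x\<in>V. 0) \<in> bounded_operators V" using zero_closed by (simp add: operator_algebra_simps)
  have F_iff: "T \<in> finite_rank_operators V \<longleftrightarrow> T \<in> bounded_operators V \<and> almost_equal V T (\<lambda>_. 0)" for T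
    by (simp add: finite_rank_operators_def almost_equal_def)
  show ?thesis
  proof (rule idealI)
    show "subgroup (finite_rank_operators V) (add_monoid (operator_algebra V))"
    proof (rule add.subgroupI)
      show "finite_rank_operators V \<subseteq> carrier (operator_algebra V)"
        by (auto simp: finite_rank_operators_def operator_algebra_simps)
      show "finite_rank_operators V \<noteq> {}"
        using zero almost_equal_refl[of V "\<lambda>x\<in>V. 0" "\<lambda>_. 0"] by (auto simp: F_iff)
    next
      fix T assume T: "T \<in> finite_rank_operators V"
      then have T': "T \<in> bounded_operators V" by (simp add: F_iff)
      have "almost_equal V (\<lambda>_. 0) T" using T by (simp add: F_iff almost_equal_sym)
      then have "almost_equal V (\<lambda>x\<in>V. - T x) (\<lambda>_. 0)" by (simp add: almost_equal_def)
      then show "\<ominus>\<^bsub>operator_algebra V\<^esub> T \<in> finite_rank_operators V"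
        using T' a_inv_closed[of T] by (simp add: F_iff operator_algebra_simps operator_algebra_a_inv[OF V])
    next
      fix S T assume *: "S \<in> finite_rank_operators V" "T \<in> finite_rank_operators V"
      then have "almost_equal V (\<lambda>x. S x + T x) T" by (simp add: almost_equal_def F_iff)
      then have "almost_equal V (\<lambda>x. S x + T x) (\<lambda>_. 0)"
        using * by (auto simp: F_iff intro: almost_equal_trans)
      then have "almost_equal V (\<lambda>x\<in>V. S x + T x) (\<lambda>_. 0)" by (simp add: almost_equal_def)
      then show "S \<oplus>\<^bsub>operator_algebra V\<^esub> T \<in> finite_rank_operators V"
        using * a_closed[of S T] by (simp add: F_iff operator_algebra_simps)
    qed
  next
    fix S T assume "S \<in> finite_rank_operators V" "T \<in> carrier (operator_algebra V)"
    then have S: "S \<in> bounded_operators V" "operator_on V V S" "almost_equal V S (\<lambda>_. 0)"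
      and T: "T \<in> bounded_operators V" "operator_on V V T"
      by (auto simp: F_iff operator_algebra_simps bounded_operators_iff)
    have "almost_equal V (T \<circ> S) (T \<circ> (\<lambda>_. 0))"
      using operator_onD(1)[OF S(2)] complex_vector.subspace_0[OF V]
      by (intro almost_equal_comp_left[OF S(3) V T(2)]) auto
    then have "almost_equal V (compose V T S) (\<lambda>_. 0)"
      by (rule almost_equal_cong) (auto simp: compose_def operator_on_zero[OF V T(2)])
    then show "T \<otimes>\<^bsub>operator_algebra V\<^esub> S \<in> finite_rank_operators V"
      by (simp add: F_iff operator_algebra_simps compose_bounded_operators[OF V T(1) S(1)])
    have "almost_equal V (S \<circ> T) ((\<lambda>_. 0) \<circ> T)"
      using operator_onD(1)[OF T(2)] by (intro almost_equal_comp_right[OF S(3)])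
    then have "almost_equal V (compose V S T) (\<lambda>_. 0)"
      by (rule almost_equal_cong) (auto simp: compose_def)
    then show "S \<otimes>\<^bsub>operator_algebra V\<^esub> T \<in> finite_rank_operators V"
      by (simp add: F_iff operator_algebra_simps compose_bounded_operators[OF V S(1) T(1)])
  qed (rule ring_axioms)
qed

text \<open>On the right, \<open>S\<close> may be any function that acts as a bounded operator on
  \<open>V\<close>. Restricting it to \<open>V\<close> makes it an element of the ring and changes
  none of the conditions, since every composite is evaluated on \<open>V\<close> only.\<close>

lemma drazin_invertible_mod_finite_rank_iff:
  assumes V: "csubspace V" and T: "T \<in> bounded_operators V"
  shows "drazin_invertible (operator_algebra V Quot finite_rank_operators V)
      (finite_rank_operators V +>\<^bsub>operator_algebra V\<^esub> T) \<longleftrightarrow>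
    (\<exists>S k. operator_on V V S \<and> almost_equal V (S \<circ> T \<circ> S) S \<and>
      almost_equal V (T \<circ> S) (S \<circ> T) \<and> almost_equal V (T ^^ k \<circ> S \<circ> T) (T ^^ k))"
    (is "?L \<longleftrightarrow> (\<exists>S k. ?P S k)")
proof -
  let ?O = "operator_algebra V"
  interpret ideal "finite_rank_operators V" ?O by (rule finite_rank_operators_ideal[OF V])
  have opT: "operator_on V V T" using T by (simp add: bounded_operators_iff)
  have key: "(S \<otimes>\<^bsub>?O\<^esub> T \<otimes>\<^bsub>?O\<^esub> S \<ominus>\<^bsub>?O\<^esub> S \<in> finite_rank_operators V \<and>
      T \<otimes>\<^bsub>?O\<^esub> S \<ominus>\<^bsub>?O\<^esub> S \<otimes>\<^bsub>?O\<^esub> T \<in> finite_rank_operators V \<and>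
      T [^]\<^bsub>?O\<^esub> k \<otimes>\<^bsub>?O\<^esub> S \<otimes>\<^bsub>?O\<^esub> T \<ominus>\<^bsub>?O\<^esub> T [^]\<^bsub>?O\<^esub> k \<in> finite_rank_operators V) \<longleftrightarrow> ?P S k"
    if S: "S \<in> bounded_operators V" for S and k :: nat
  proof -
    have opS: "operator_on V V S" using S by (simp add: bounded_operators_iff)
    have inV: "S x \<in> V" "T x \<in> V" if "x \<in> V" for x
      using operator_onD(1)[OF opS that] operator_onD(1)[OF opT that] by auto
    have c: "S \<otimes>\<^bsub>?O\<^esub> T \<otimes>\<^bsub>?O\<^esub> S \<in> bounded_operators V" "T \<otimes>\<^bsub>?O\<^esub> S \<in> bounded_operators V"
        "S \<otimes>\<^bsub>?O\<^esub> T \<in> bounded_operators V" "T [^]\<^bsub>?O\<^esub> k \<in> bounded_operators V"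
        "T [^]\<^bsub>?O\<^esub> k \<otimes>\<^bsub>?O\<^esub> S \<otimes>\<^bsub>?O\<^esub> T \<in> bounded_operators V"
      using S T m_closed nat_pow_closed[of T k] by (simp_all add: operator_algebra_simps(1))
    show ?thesis
      unfolding finite_rank_minus_iff[OF V c(1) S] finite_rank_minus_iff[OF V c(2,3)]
        finite_rank_minus_iff[OF V c(5,4)] almost_equal_def
      using opS inV
      by (simp add: operator_algebra_simps operator_algebra_nat_pow[OF V T] compose_def cong: image_cong_simp)
  qed
  have "?L \<longleftrightarrow> (\<exists>S\<in>bounded_operators V. \<exists>k. ?P S k)"
    using drazin_invertible_Quot_iff[of T] T key by (simp add: operator_algebra_simps(1))
  also have "\<dots> \<longleftrightarrow> (\<exists>S k. ?P S k)"
  proof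
    assume "\<exists>S k. ?P S k"
    then obtain S k where S: "operator_on V V S" "almost_equal V (S \<circ> T \<circ> S) S"
      "almost_equal V (T \<circ> S) (S \<circ> T)" "almost_equal V (T ^^ k \<circ> S \<circ> T) (T ^^ k)" by blast
    have inV: "S x \<in> V" "T x \<in> V" if "x \<in> V" for x
      using operator_onD(1)[OF S(1) that] operator_onD(1)[OF opT that] by auto
    have "restrict S V \<in> bounded_operators V" by (rule restrict_bounded_operators[OF V S(1)])
    moreover have "?P (restrict S V) k"
      using S inV operator_on_cong[OF S(1) V, of "restrict S V"] unfolding almost_equal_def
      by (simp cong: image_cong_simp)
    ultimately show "\<exists>S\<in>bounded_operators V. \<exists>k. ?P S k" by blast
  qed blast
  finally show ?thesis .
qed

text \<open>Berkani's theorem for a closed subspace with enough functionals. In both directions the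
  same number serves as exponent of the range and as Drazin index.\<close>

theorem b_fredholm_operator_iff_drazin_invertible:
  assumes V: "csubspace V" "closed V" "separated_by_functionals V" and T: "T \<in> bounded_operators V"
  shows "b_fredholm_operator V T \<longleftrightarrow>
    drazin_invertible (operator_algebra V Quot finite_rank_operators V)
      (finite_rank_operators V +>\<^bsub>operator_algebra V\<^esub> T)"
proof -
  have opT: "operator_on V V T" using T by (simp add: bounded_operators_iff)
  \<comment> \<open>The range of a power is invariant under \<open>T\<close>, so the restriction is
    a bounded operator there and may be replaced by \<open>T\<close> in the kernel and range
    conditions.\<close>
  have fred: "fredholm_operator M (restrict T M) \<longleftrightarrow>
      finite_dimensional {x\<in>M. T x = 0} \<and> (\<exists>B. finite B \<and> B \<subseteq> M \<and> M = cspan (T ` M \<union> B))"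
    if M: "M = (T ^^ n) ` V" for M n
  proof -
    have Tn: "operator_on V V (T ^^ n)" by (rule operator_on_funpow[OF opT])
    have MV: "M \<subseteq> V" unfolding M using operator_onD(1)[OF Tn] by blast
    have "T ` V \<subseteq> V" using operator_onD(1)[OF opT] by blast
    from funpow_image_invariant[OF this, of n] have "T x \<in> M" if "x \<in> M" for x
      using that unfolding M by blast
    then have "operator_on M M T" by (rule operator_on_mono[OF opT MV])
    moreover have "csubspace M" unfolding M by (rule csubspace_image[OF V(1) Tn])
    ultimately have "restrict T M \<in> bounded_operators M" by (intro restrict_bounded_operators)
    then show ?thesis
      unfolding fredholm_operator_def by (simp cong: conj_cong image_cong_simp)
  qed
  have closed: "closedin (top_of_set V) M \<longleftrightarrow> closed M" if "M \<subseteq> V" for M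
    using closedin_closed_eq[OF V(2), of M] that by auto
  show ?thesis
    unfolding drazin_invertible_mod_finite_rank_iff[OF V(1) T]
  proof
    assume "b_fredholm_operator V T"
    then obtain n where n: "closedin (top_of_set V) ((T ^^ n) ` V)"
      "fredholm_operator ((T ^^ n) ` V) (restrict T ((T ^^ n) ` V))"
      unfolding b_fredholm_operator_def by blast
    have sub: "(T ^^ n) ` V \<subseteq> V" using operator_onD(1)[OF operator_on_funpow[OF opT]] by blast
    have "closed ((T ^^ n) ` V)" using n(1) closed[OF sub] by simp
    moreover obtain B where "finite_dimensional {x\<in>(T ^^ n) ` V. T x = 0}" "finite B" "B \<subseteq> (T ^^ n) ` V"
        "(T ^^ n) ` V = cspan (T ` (T ^^ n) ` V \<union> B)"
      using n(2) unfolding fred[OF refl] by blast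
    ultimately show "\<exists>S k. operator_on V V S \<and> almost_equal V (S \<circ> T \<circ> S) S \<and>
      almost_equal V (T \<circ> S) (S \<circ> T) \<and> almost_equal V (T ^^ k \<circ> S \<circ> T) (T ^^ k)"
      using fredholm_on_range_imp_drazin_mod_finite_rank[OF V(1,3) opT refl] by blast
  next
    assume "\<exists>S k. operator_on V V S \<and> almost_equal V (S \<circ> T \<circ> S) S \<and>
      almost_equal V (T \<circ> S) (S \<circ> T) \<and> almost_equal V (T ^^ k \<circ> S \<circ> T) (T ^^ k)"
    then obtain S k where S: "operator_on V V S" "almost_equal V (T \<circ> S) (S \<circ> T)"
      "almost_equal V (T ^^ k \<circ> S \<circ> T) (T ^^ k)" by blast
    have sub: "(T ^^ k) ` V \<subseteq> V" using operator_onD(1)[OF operator_on_funpow[OF opT]] by blast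
    note * = drazin_mod_finite_rank_imp_fredholm_on_range[OF V S(1) opT S(2,3) refl]
    have "fredholm_operator ((T ^^ k) ` V) (restrict T ((T ^^ k) ` V))"
      unfolding fred[OF refl] using *(2,3) by blast
    then show "b_fredholm_operator V T"
      unfolding b_fredholm_operator_def using T *(1) closed[OF sub] by blast
  qed
qed

section \<open>The left regular representation of a primitive algebra\<close>

text \<open>Let \<open>L\<close> be a maximal left ideal whose associated primitive ideal is zero.
  As \<open>b\<close> is nonzero, some \<open>b * y\<close> lies outside \<open>L\<close>, and by
  maximality \<open>1 = z * (b * y) + l\<close> with \<open>l\<close> in \<open>L\<close>.
  Multiplying on the left by \<open>a * w\<close> kills the first term, so \<open>a * w\<close> lies
  in \<open>L\<close> for every \<open>w\<close>, which forces \<open>a = 0\<close>.\<close>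

lemma primitive_imp_prime:
  fixes a b :: "'a::complex_banach_algebra"
  assumes "primitive_ideal {0::'a}" and ab: "\<And>x. a * x * b = 0" and "b \<noteq> 0"
  shows "a = 0"
proof -
  obtain L :: "'a set" where "maximal_left_ideal L" and zero: "{0} = {a. \<forall>x. a * x \<in> L}"
    using assms(1) unfolding primitive_ideal_def by blast
  then have L: "left_ideal L" "\<And>N. left_ideal N \<Longrightarrow> L \<subseteq> N \<Longrightarrow> N = L \<or> N = UNIV"
    unfolding maximal_left_ideal_def by auto
  have sub: "csubspace L" and Lmul: "\<And>c x. x \<in> L \<Longrightarrow> c * x \<in> L"
    using L(1) by (auto simp: left_ideal_def)
  have zero_iff: "(\<forall>x. c * x \<in> L) \<longleftrightarrow> c = 0" for c using zero by (auto simp: set_eq_iff)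
  then obtain y where y: "b * y \<notin> L" using \<open>b \<noteq> 0\<close> by metis
  define N where "N = {z * (b * y) + l |z l. l \<in> L}"
  have "left_ideal N"
    unfolding left_ideal_def complex_vector.subspace_def
  proof (intro conjI ballI allI)
    show "0 \<in> N"
      unfolding N_def using complex_vector.subspace_0[OF sub] by (auto intro!: exI[of _ 0])
  next
    fix u v assume "u \<in> N" "v \<in> N"
    then obtain z l z' l' where "u = z * (b * y) + l" "v = z' * (b * y) + l'" "l \<in> L" "l' \<in> L"
      by (auto simp: N_def)
    then have "u + v = (z + z') * (b * y) + (l + l')" "l + l' \<in> L"
      using complex_vector.subspace_add[OF sub] by (simp_all add: distrib_right)
    then show "u + v \<in> N" unfolding N_def by blast
  next
    fix c u assume "u \<in> N"
    then obtain z l where "u = z * (b * y) + l" "l \<in> L" by (auto simp: N_def)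
    then have "c *\<^sub>C u = (c *\<^sub>C z) * (b * y) + c *\<^sub>C l" "c *\<^sub>C l \<in> L"
      using complex_vector.subspace_scale[OF sub] by (simp_all add: scaleC_add_right mult_scaleC_left)
    then show "c *\<^sub>C u \<in> N" unfolding N_def by blast
  next
    fix c u assume "u \<in> N"
    then obtain z l where "u = z * (b * y) + l" "l \<in> L" by (auto simp: N_def)
    then have "c * u = (c * z) * (b * y) + c * l" "c * l \<in> L"
      using Lmul by (simp_all add: distrib_left mult.assoc)
    then show "c * u \<in> N" unfolding N_def by blast
  qed
  moreover have "L \<subseteq> N"
  proof
    fix l assume "l \<in> L"
    then have "l = 0 * (b * y) + l" "l \<in> L" by simp_all
    then show "l \<in> N" unfolding N_def by blast
  qed
  moreover have "N \<noteq> L"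
  proof -
    have "b * y = 1 * (b * y) + 0" "0 \<in> L" using complex_vector.subspace_0[OF sub] by simp_all
    then have "b * y \<in> N" unfolding N_def by blast
    with y show ?thesis by blast
  qed
  ultimately have "N = UNIV" using L(2) by blast
  then have "1 \<in> N" by simp
  then obtain z l where one: "1 = z * (b * y) + l" "l \<in> L" unfolding N_def by blast
  have "a * w \<in> L" for w
  proof -
    have "a * w = a * w * (z * (b * y) + l)" by (simp flip: one(1))
    also have "\<dots> = (a * (w * z) * b) * y + (a * w) * l" by (simp add: distrib_left mult.assoc)
    finally have "a * w = (a * w) * l" by (simp add: ab)
    with Lmul[OF one(2), of "a * w"] show ?thesis by simp
  qed
  then show ?thesis using zero_iff by blast
qed

section \<open>The Banach space \<open>Ap\<close> and the action of \<open>A\<close> on it\<close>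

lemma principal_left_ideal_csubspace: "csubspace (principal_left_ideal p)"
  unfolding complex_vector.subspace_def principal_left_ideal_def
proof safe
  fix c x y
  show "0 \<in> range (\<lambda>x. x * p)" by (rule range_eqI[of _ _ 0]) simp
  show "x * p + y * p \<in> range (\<lambda>x. x * p)" by (rule range_eqI[of _ _ "x + y"]) (simp add: distrib_right)
  show "c *\<^sub>C (x * p) \<in> range (\<lambda>x. x * p)"
    by (rule range_eqI[of _ _ "c *\<^sub>C x"]) (simp add: mult_scaleC_left)
qed

lemma principal_left_ideal_closed:
  fixes p :: "'a::complex_banach_algebra"
  assumes "p * p = p"
  shows "closed (principal_left_ideal p)"
proof -
  have "principal_left_ideal p = {x. x * p = x}"
    using assms by (auto simp: principal_left_ideal_def mult.assoc) (metis rangeI)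
  moreover have "closed {x. x * p = x}"
    by (intro closed_Collect_eq continuous_intros)
  ultimately show ?thesis by simp
qed

text \<open>Because \<open>pAp\<close> consists of the multiples of \<open>p\<close>, the map
  sending \<open>y\<close> to \<open>p * (b * y) * p\<close> is a scalar functional \<phi> times
  \<open>p\<close>, bounded since multiplication is. Primeness supplies a \<open>b\<close> with
  \<open>p * b * v \<noteq> 0\<close>, and \<open>v * p = v\<close> turns this into
  \<open>\<phi> v \<noteq> 0\<close>.\<close>

lemma principal_left_ideal_separated:
  fixes p :: "'a::complex_banach_algebra"
  assumes "primitive_ideal {0::'a}" and p: "minimal_idempotent p"
  shows "separated_by_functionals (principal_left_ideal p)"
  unfolding separated_by_functionals_def
proof (intro ballI impI)
  fix v assume v: "v \<in> principal_left_ideal p" "v \<noteq> 0"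
  have p0: "p \<noteq> 0" "p * p = p" using p by (auto simp: minimal_idempotent_def)
  have vp: "v * p = v" using v(1) p0(2) by (auto simp: principal_left_ideal_def mult.assoc)
  obtain b where b: "p * b * v \<noteq> 0" using primitive_imp_prime[OF assms(1)] v(2) p0(1) by blast
  have "\<exists>c. p * (b * y) * p = c *\<^sub>C p" for y
    using p unfolding minimal_idempotent_def by (metis (no_types, lifting) image_iff rangeI)
  then obtain \<phi> where \<phi>: "\<And>y. p * (b * y) * p = \<phi> y *\<^sub>C p" by metis
  have eqI: "c = d" if "c *\<^sub>C p = d *\<^sub>C p" for c d
    using that p0(1) by (simp add: complex_vector.scale_cancel_right)
  have "\<phi> (x + y) = \<phi> x + \<phi> y" for x y
    by (rule eqI) (simp add: scaleC_add_left distrib_left distrib_right flip: \<phi>)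
  moreover have "\<phi> (c *\<^sub>C x) = c * \<phi> x" for c x
    by (rule eqI) (simp add: mult_scaleC_right mult_scaleC_left flip: \<phi> scaleC_scaleC)
  moreover have "cmod (\<phi> y) \<le> (norm p * norm b * norm p / norm p) * norm y" for y
  proof -
    have "cmod (\<phi> y) * norm p = norm (p * (b * y) * p)" by (simp add: \<phi> norm_scaleC)
    also have "\<dots> \<le> norm p * (norm b * norm y) * norm p"
      by (intro order_trans[OF norm_mult_ineq] mult_mono order_refl norm_mult_ineq mult_nonneg_nonneg norm_ge_zero)
    finally show ?thesis using p0(1) by (simp add: field_simps)
  qed
  moreover have "\<phi> v \<noteq> 0"
  proof
    assume "\<phi> v = 0"
    then have "p * (b * v) * p = 0" by (simp add: \<phi>)
    then have "p * b * (v * p) = 0" by (simp add: mult.assoc)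
    with b vp show False by simp
  qed
  ultimately show "\<exists>\<phi>. (\<forall>x y. \<phi> (x + y) = \<phi> x + \<phi> y) \<and> (\<forall>c x. \<phi> (c *\<^sub>C x) = c * \<phi> x) \<and>
      (\<exists>K. \<forall>x. cmod (\<phi> x) \<le> K * norm x) \<and> \<phi> v \<noteq> 0"
    by blast
qed

lemma principal_left_ideal_mult: "y \<in> principal_left_ideal p \<Longrightarrow> x * y \<in> principal_left_ideal p"
  by (auto simp: principal_left_ideal_def simp flip: mult.assoc)

lemma left_regular_bounded: "left_regular p x \<in> bounded_operators (principal_left_ideal p)"
proof -
  have "operator_on (principal_left_ideal p) (principal_left_ideal p) (\<lambda>y. x * y)"
    unfolding operator_on_def
    using principal_left_ideal_mult norm_mult_ineq
    by (auto simp: distrib_left mult_scaleC_right intro!: exI[of _ "norm x"])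
  then show ?thesis
    unfolding left_regular_def by (rule restrict_bounded_operators[OF principal_left_ideal_csubspace])
qed

lemma left_regular_ring_hom:
  "ring_hom_ring ring_of_type_algebra (operator_algebra (principal_left_ideal p)) (left_regular p)"
proof (rule ring_hom_ringI)
  show "ring (ring_of_type_algebra :: 'a ring)" by (rule ring_of_type_algebra_ring)
  show "ring (operator_algebra (principal_left_ideal p))"
    by (rule operator_algebra_ring[OF principal_left_ideal_csubspace])
qed (auto simp: ring_of_type_algebra_def operator_algebra_simps left_regular_bounded,
    auto simp: left_regular_def compose_def principal_left_ideal_mult distrib_right mult.assoc intro!: restrict_ext)

text \<open>If \<open>x\<close> and \<open>y\<close> act alike on \<open>Ap\<close>, then
  \<open>(x - y) * w * p = 0\<close> for all \<open>w\<close>, and primeness applies with the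
  nonzero element \<open>p\<close>.\<close>

lemma left_regular_inj:
  fixes p :: "'a::complex_banach_algebra"
  assumes "primitive_ideal {0::'a}" "p \<noteq> 0"
  shows "inj (left_regular p)"
proof (rule injI)
  fix x y assume eq: "left_regular p x = left_regular p y"
  have "(x - y) * w * p = 0" for w
  proof -
    have "w * p \<in> principal_left_ideal p" by (simp add: principal_left_ideal_def)
    then have "x * (w * p) = y * (w * p)" using fun_cong[OF eq, of "w * p"] by (simp add: left_regular_def)
    then show ?thesis by (simp add: left_diff_distrib mult.assoc)
  qed
  then have "x - y = 0" using primitive_imp_prime[OF assms(1) _ assms(2)] by blast
  then show "x = y" by simp
qed

lemma (in ideal) ideal_in_subring:
  assumes H: "subring H R" and "I \<subseteq> H"
  shows "ideal I (R\<lparr>carrier := H\<rparr>)"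
proof (rule idealI)
  show "ring (R\<lparr>carrier := H\<rparr>)" by (rule subring_is_ring[OF H])
  have "subgroup I (add_monoid R\<lparr>carrier := H\<rparr>)"
    using add.subgroup_incl[OF additive_subgroup.a_subgroup[OF is_additive_subgroup] subring.axioms(1)[OF H] assms(2)]
    by simp
  then show "subgroup I (add_monoid (R\<lparr>carrier := H\<rparr>))" by simp
qed (use subringE(1)[OF H] I_l_closed I_r_closed in auto)

theorem theorem3p8:
  fixes p :: "'a::complex_banach_algebra"
  assumes primitive: "primitive_ideal {0::'a}"
    and socle_nonzero: "(socle :: 'a set) \<noteq> {0}"
    and p: "minimal_idempotent p"
    and socle_image: "left_regular p ` socle = finite_rank_operators (principal_left_ideal p)"
  shows
    "(\<forall>a::'a. b_fredholm_operator (principal_left_ideal p) (left_regular p a) \<longrightarrow> b_fredholm_element a)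
     \<longleftrightarrow>
     (\<forall>c \<in> carrier (left_regular_image p Quot finite_rank_operators (principal_left_ideal p)).
        drazin_invertible
          (operator_algebra (principal_left_ideal p) Quot finite_rank_operators (principal_left_ideal p)) c \<longrightarrow>
        drazin_invertible
          (left_regular_image p Quot finite_rank_operators (principal_left_ideal p)) c)"
proof -
  define V where "V = principal_left_ideal p"
  let ?A = "ring_of_type_algebra :: 'a ring"
  let ?O = "operator_algebra V"
  let ?F = "finite_rank_operators V"
  let ?H = "left_regular_image p"
  have p0: "p \<noteq> 0" "p * p = p" using p by (auto simp: minimal_idempotent_def)
  have V: "csubspace V" "closed V" "separated_by_functionals V"
    unfolding V_def
    by (rule principal_left_ideal_csubspace principal_left_ideal_closed[OF p0(2)]
        principal_left_ideal_separated[OF primitive p])+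
  interpret h: ring_hom_ring ?A ?O "left_regular p" unfolding V_def by (rule left_regular_ring_hom)
  interpret F: ideal ?F ?O by (rule finite_rank_operators_ideal[OF V(1)])
  have carrier_A: "carrier ?A = UNIV" by (simp add: ring_of_type_algebra_def)
  have H: "?H = ?O\<lparr>carrier := range (left_regular p)\<rparr>" by (simp add: left_regular_image_def V_def)
  have carrier_H: "carrier ?H = range (left_regular p)" by (simp add: H)
  have subring: "subring (range (left_regular p)) ?O"
    using h.img_is_subring[OF h.R.carrier_is_subring] by (simp add: carrier_A)
  have F_sub: "?F \<subseteq> range (left_regular p)" using socle_image by (auto simp flip: V_def)
  have F_H: "ideal ?F ?H" unfolding H by (rule F.ideal_in_subring[OF subring F_sub])
  have inj: "inj (left_regular p)" by (rule left_regular_inj[OF primitive p0(1)])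
  \<comment> \<open>Injectivity upgrades the hypothesis on the image of the socle to a statement
    about preimages. In particular the socle is a two-sided ideal, as the preimage of one.\<close>
  have socle_iff: "left_regular p x \<in> ?F \<longleftrightarrow> x \<in> socle" for x
    using inj_image_mem_iff[OF inj, of x socle] socle_image by (simp flip: V_def)
  have "socle = {x \<in> carrier ?A. left_regular p x \<in> ?F}" by (simp add: socle_iff carrier_A)
  then have socle_ideal: "ideal socle ?A" using h.ideal_vimage[OF F.ideal_axioms] by simp
  have hom_H: "ring_hom_ring ?A ?H (left_regular p)"
  proof (rule ring_hom_ringI)
    show "ring ?H" unfolding H by (rule h.S.subring_is_ring[OF subring])
  qed (use h.R.ring_axioms h.hom_mult h.hom_add h.hom_one in \<open>auto simp: H carrier_A\<close>)
  have coset: "?F +>\<^bsub>?H\<^esub> x = ?F +>\<^bsub>?O\<^esub> x" for x unfolding H by (rule rcos_carrier_update)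
  have element: "b_fredholm_element a \<longleftrightarrow> drazin_invertible (?H Quot ?F) (?F +>\<^bsub>?O\<^esub> left_regular p a)" for a
    unfolding b_fredholm_element_def coset[symmetric]
    by (rule drazin_invertible_Quot_hom[OF hom_H _ socle_ideal F_H, symmetric])
      (simp_all add: carrier_A carrier_H socle_iff)
  have operator: "b_fredholm_operator V (left_regular p a) \<longleftrightarrow>
      drazin_invertible (?O Quot ?F) (?F +>\<^bsub>?O\<^esub> left_regular p a)" for a
    by (rule b_fredholm_operator_iff_drazin_invertible[OF V]) (simp add: V_def left_regular_bounded)
  \<comment> \<open>Quantifying over the classes \<open>c\<close> amounts to quantifying over
    \<open>a\<close>. By \<open>element\<close> and \<open>operator\<close>, the two implications
    then agree for each single \<open>a\<close>.\<close>
  have "carrier (?H Quot ?F) = range (\<lambda>a. ?F +>\<^bsub>?O\<^esub> left_regular p a)"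
    unfolding FactRing_def A_RCOSETS_def' partial_object.simps coset carrier_H by auto
  then show ?thesis
    unfolding V_def[symmetric] element operator by simp
qed

end
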